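(* Let $s$ be a square-free integer with $17\leq s\leq 511$ and $3\nmid s$, and let $K=\mathbb{Q}(\sqrt{3},\sqrt{s})$. Then $\mathcal{P}(\mathcal{O}_K)\geq 6$, with at most eight exceptions among such $s$ (the possible exceptions being $s\in\{170,178,230,238,362,442,446,454\}$). Moreover, if $s\equiv 1\pmod 4$ (square-free, $3\nmid s$), then $\mathcal{P}(\mathcal{O}_K)\geq 6$ holds for all $s$ with $17\leq s<15000$, with $315^2<s<317^2$, with $999^2<s<1001^2$, and with $3161^2<s<3165^2$.
   Context: For a commutative ring $R$, let $\sum R^2$ denote the set of finite sums of squares in $R$; the length $\ell(\alpha)$ of $\alpha\in\sum R^2$ is the minimal number of squares summing to $\alpha$, and the Pythagoras number is $\mathcal{P}(R)=\sup\{\ell(\alpha):\alpha\in\sum R^2\}$. $\mathcal{O}_K$ is the ring of integers of $K$. The conditions on $s$ (square-free, $s>3$, $3\nmid s$) are exactly the conditions that $3<s<3s$ are the three square-free integers $>1$ that are squares in $K$, with $3$ and $s$ the two smallest. *)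

theory Defs
  imports
    Complex_Main
    "HOL-Library.Extended_Nat"
    "HOL-Computational_Algebra.Computational_Algebra"
    "HOL-Algebra.Generated_Fields"
    "HOL-Algebra.Algebraic_Closure_Type"
begin

definition is_sum_of_n_squares :: "('a, 'b) ring_scheme \<Rightarrow> nat \<Rightarrow> 'a \<Rightarrow> bool" where
  "is_sum_of_n_squares R n a \<longleftrightarrow>
     (\<exists>f \<in> {..<n} \<rightarrow> carrier R. a = (\<Oplus>\<^bsub>R\<^esub>i\<in>{..<n}. f i [^]\<^bsub>R\<^esub> (2::nat)))"

definition sums_of_squares :: "('a, 'b) ring_scheme \<Rightarrow> 'a set" where
  "sums_of_squares R = {a. \<exists>n. is_sum_of_n_squares R n a}"

(* Only meaningful for elements of sums_of_squares R. *)
definition sq_length :: "('a, 'b) ring_scheme \<Rightarrow> 'a \<Rightarrow> nat" where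
  "sq_length R a = (LEAST n. is_sum_of_n_squares R n a)"

(* Extended naturals, because the lengths may be unbounded. *)
definition pythagoras_number :: "('a, 'b) ring_scheme \<Rightarrow> enat" where
  "pythagoras_number R = (SUP a \<in> sums_of_squares R. enat (sq_length R a))"

(* The field generated by S inside the ambient field; since that field has
   characteristic 0, it contains the rationals. *)
definition rat_adjoin :: "'a :: field_char_0 set \<Rightarrow> 'a set" where
  "rat_adjoin S = generate_field ring_of_type_algebra S"

definition ring_of_integers :: "'a :: field_char_0 set \<Rightarrow> 'a ring" where
  "ring_of_integers K = ring_of_type_algebra\<lparr>carrier := {x \<in> K. algebraic_int x}\<rparr>"

end

theory Submission
  imports Defs "HOL-Analysis.Convex"
begin

text \<open>
  Let \<open>R = \<int>[\<surd>3]\<close>. The ring of integers is \<open>R \<oplus> R\<omega>\<close>, where \<open>\<omega> = (n + \<surd>s)/2\<close> for odd \<open>s\<close> and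
  \<open>\<omega> = n + (1 + \<surd>3)\<surd>s/2\<close> for even \<open>s\<close>, with a parameter \<open>n \<in> R\<close> that may be chosen freely up to a
  congruence modulo 2. The binary form with Gram matrix \<open>(7 + 2\<surd>3, 2 + \<surd>3; 2 + \<surd>3, 7 + 2\<surd>3)\<close> over \<open>R\<close>
  is a sum of six, but not of five squares of linear forms. Evaluate it at \<open>(\<omega>, 1)\<close>. If the
  value is \<open>\<Sum>(d\<^sub>i + b\<^sub>i\<omega>)\<^sup>2\<close>, then the Gram matrix of \<open>b\<close> and \<open>d\<close> is determined by \<open>z \<in> R\<close> with
  \<open>\<Sum>b\<^sub>i\<^sup>2 = 7 + 2\<surd>3 + 2z\<close>, and the Cauchy--Schwarz inequality in both embeddings of \<open>R\<close> becomes a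
  quadratic inequality for \<open>z\<close> which, when \<open>n\<^sup>2\<close> is close to \<open>s\<close>, forces \<open>z = 0\<close>. So the value has
  length six. For \<open>s = 17\<close> and \<open>s = 19\<close> the form is evaluated at another pair of generators of the
  ring of integers, and \<open>s = 23\<close> needs a second form. No exceptions remain.
\<close>

section \<open>The ring \<open>\<int>[\<surd>3]\<close>\<close>

text \<open>The two coordinates of the value give two equations for the three Gram entries of
  \<open>b\<close> and \<open>d\<close>, so one element of \<int>[sqrt 3] stays free. Its factor 2
  comes from parity: a sum of squares there has an even sqrt 3-coordinate. With \<omega>^2 = \<tau>
  \<omega> + \<nu>, the inequality at \<open>(\<omega>, 1)\<close> says that \<Delta> + 2 \<kappa> z
  - \<sigma> z^2 is totally nonnegative. Here \<Delta> = 54 + 24 sqrt 3 is the determinant of the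
  form, \<sigma> = \<tau>^2 + 4 \<nu> is the discriminant of \<omega>, independent of n, and
  \<kappa> = (7 + 2 sqrt 3)(1 - \<nu>) + (2 + sqrt 3) \<tau>. So n only steers \<kappa>: it should
  make \<nu> small, and its sign should let the two terms cancel. For odd s the trace of the
  inequality can suffice only when s > 54; smaller s also need the norm, checked on a few lattice
  points. For s congruent to 1 modulo 4 an odd rational n lies within 1 of sqrt s, which settles all
  large s uniformly. In the other classes a finite table of n reaches s = 511.\<close>

datatype (plugins del: code) zsqrt3 = Z3 (rpart: int) (spart: int)

lemma zsqrt3_eq_iff: "z = w \<longleftrightarrow> rpart z = rpart w \<and> spart z = spart w"
  by (cases z; cases w) auto

instantiation zsqrt3 :: comm_ring_1
begin

definition zero_zsqrt3 where "0 = Z3 0 0"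
definition one_zsqrt3 where "1 = Z3 1 0"
definition plus_zsqrt3 where "z + w = Z3 (rpart z + rpart w) (spart z + spart w)"
definition minus_zsqrt3 where "z - w = Z3 (rpart z - rpart w) (spart z - spart w)"
definition uminus_zsqrt3 where "- z = Z3 (- rpart z) (- spart z)"
definition times_zsqrt3 where
  "z * w = Z3 (rpart z * rpart w + 3 * (spart z * spart w)) (rpart z * spart w + spart z * rpart w)"

lemma zsqrt3_parts [simp]:
  "rpart 0 = 0" "spart 0 = 0" "rpart 1 = 1" "spart 1 = 0"
  "rpart (z + w) = rpart z + rpart w" "spart (z + w) = spart z + spart w"
  "rpart (z - w) = rpart z - rpart w" "spart (z - w) = spart z - spart w"
  "rpart (- z) = - rpart z" "spart (- z) = - spart z"
  "rpart (z * w) = rpart z * rpart w + 3 * (spart z * spart w)"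
  "spart (z * w) = rpart z * spart w + spart z * rpart w"
  by (simp_all only: zero_zsqrt3_def one_zsqrt3_def plus_zsqrt3_def minus_zsqrt3_def
      uminus_zsqrt3_def times_zsqrt3_def zsqrt3.sel)

instance
  by standard (simp_all add: zsqrt3_eq_iff algebra_simps)

end

lemma zsqrt3_of_nat [simp]: "rpart (of_nat n) = int n" "spart (of_nat n) = 0"
  by (induction n) simp_all

lemma zsqrt3_of_int [simp]: "rpart (of_int k) = k" "spart (of_int k) = 0"
  by (cases k rule: int_cases2; simp)+

lemma zsqrt3_numeral [simp]:
  "rpart (numeral n) = numeral n" "spart (numeral n) = 0"
  using zsqrt3_of_int[of "numeral n"] by (simp_all only: of_int_numeral)

lemma rpart_sum: "rpart (sum f A) = (\<Sum>x\<in>A. rpart (f x))"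
  by (induction A rule: infinite_finite_induct) auto

lemma spart_sum: "spart (sum f A) = (\<Sum>x\<in>A. spart (f x))"
  by (induction A rule: infinite_finite_induct) auto

definition emb :: "zsqrt3 \<Rightarrow> real" where
  "emb z = of_int (rpart z) + of_int (spart z) * sqrt 3"

definition emb' :: "zsqrt3 \<Rightarrow> real" where
  "emb' z = of_int (rpart z) - of_int (spart z) * sqrt 3"

lemma emb_simps [simp]:
  "emb 0 = 0" "emb 1 = 1" "emb (z + w) = emb z + emb w" "emb (z - w) = emb z - emb w"
  "emb (- z) = - emb z" "emb (z * w) = emb z * emb w"
  by (simp_all add: emb_def algebra_simps)

lemma emb'_simps [simp]:
  "emb' 0 = 0" "emb' 1 = 1" "emb' (z + w) = emb' z + emb' w" "emb' (z - w) = emb' z - emb' w"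
  "emb' (- z) = - emb' z" "emb' (z * w) = emb' z * emb' w"
  by (simp_all add: emb'_def algebra_simps)

lemma emb_sum: "emb (sum f A) = (\<Sum>x\<in>A. emb (f x))"
  by (induction A rule: infinite_finite_induct) auto

lemma emb'_sum: "emb' (sum f A) = (\<Sum>x\<in>A. emb' (f x))"
  by (induction A rule: infinite_finite_induct) auto

definition totally_nonneg :: "zsqrt3 \<Rightarrow> bool" where
  "totally_nonneg z \<longleftrightarrow> 0 \<le> emb z \<and> 0 \<le> emb' z"

text \<open>Trace and norm to the rationals are nonnegative. This replaces the two real inequalities
  by integer inequalities in the coordinates.\<close>

lemma totally_nonnegD:
  assumes "totally_nonneg z"
  shows "0 \<le> rpart z" "3 * (spart z)\<^sup>2 \<le> (rpart z)\<^sup>2"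
proof -
  have pos: "0 \<le> emb z" "0 \<le> emb' z"
    using assms by (auto simp: totally_nonneg_def)
  then have "0 \<le> emb z + emb' z" by simp
  then show "0 \<le> rpart z" by (simp add: emb_def emb'_def)
  have "0 \<le> emb z * emb' z" using pos by simp
  also have "emb z * emb' z = of_int ((rpart z)\<^sup>2 - 3 * (spart z)\<^sup>2)"
    by (simp add: emb_def emb'_def algebra_simps power2_eq_square)
  finally show "3 * (spart z)\<^sup>2 \<le> (rpart z)\<^sup>2"
    unfolding of_int_0_le_iff by linarith
qed

lemma totally_nonneg_Cauchy_Schwarz:
  "totally_nonneg ((\<Sum>i\<in>A. b i * b i) * (\<Sum>i\<in>A. d i * d i) - (\<Sum>i\<in>A. b i * d i) * (\<Sum>i\<in>A. b i * d i))"
  using Cauchy_Schwarz_ineq_sum[of "\<lambda>i. emb (b i)" "\<lambda>i. emb (d i)" A]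
    Cauchy_Schwarz_ineq_sum[of "\<lambda>i. emb' (b i)" "\<lambda>i. emb' (d i)" A]
  by (simp add: totally_nonneg_def emb_sum emb'_sum power2_eq_square)

section \<open>Binary forms that need six squares\<close>

text \<open>With b_j = x_j + y_j sqrt 3 the hypotheses say that five squares b_j^2 add up to 7 + 2
  sqrt 3. Some term has a positive mixed product and spends at least 4 of the total 7; up to order
  and signs only (1 + sqrt 3)^2 + 1 + 1 + 1 + 0 and (1 + sqrt 3)^2 + (sqrt 3)^2 + 0 + 0 + 0
  survive.\<close>

lemma seven_two_decomposition:
  fixes x y :: "'a \<Rightarrow> int"
  assumes fin: "finite I" and card: "card I = 5"
    and q: "(\<Sum>j\<in>I. x j * x j + 3 * (y j * y j)) = 7" and p: "(\<Sum>j\<in>I. x j * y j) = 1"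
  obtains i k e where "i \<in> I" "k \<in> I" "i \<noteq> k" "x i = e" "y i = e" "\<bar>e\<bar> = 1"
    "x k = 0 \<and> y k = 0 \<and> (\<forall>j\<in>I - {i, k}. \<bar>x j\<bar> = 1 \<and> y j = 0) \<or>
     x k = 0 \<and> \<bar>y k\<bar> = 1 \<and> (\<forall>j\<in>I - {i, k}. x j = 0 \<and> y j = 0)"
proof -
  define Q where "Q j = x j * x j + 3 * (y j * y j)" for j
  have Q0: "0 \<le> Q j" for j by (simp add: Q_def)
  obtain i where i: "i \<in> I" "0 < x i * y i"
    using p sum_nonpos[of I "\<lambda>j. x j * y j"] by force
  define J where "J = I - {i}"
  have J: "finite J" "card J = 4" "i \<notin> J" "J \<subseteq> I" using fin card i by (auto simp: J_def)
  have qi: "Q i + sum Q J = 7" and pi: "x i * y i + (\<Sum>j\<in>J. x j * y j) = 1"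
    using q p sum.remove[OF fin i(1), of Q] sum.remove[OF fin i(1), of "\<lambda>j. x j * y j"]
    by (auto simp: Q_def J_def)
  have le: "Q j \<le> sum Q J" if "j \<in> J" for j using member_le_sum[OF that Q0 J(1)] by simp
  have sJ: "0 \<le> sum Q J" using Q0 by (simp add: sum_nonneg)
  have ge: "n * n \<le> m * m" if "n \<ge> 0" "m \<ge> n \<or> m \<le> - n" for m n :: int
    using that mult_mono[of n m n m] mult_mono[of n "-m" n "-m"] by auto
  have yi: "\<bar>y i\<bar> < 2"
  proof (rule ccontr)
    assume "\<not> \<bar>y i\<bar> < 2"
    then have "2 * 2 \<le> y i * y i" by (intro ge) auto
    then show False using qi sJ by (simp add: Q_def)
      (smt (verit) zero_le_square)
  qed
  have xi: "\<bar>x i\<bar> < 3"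
  proof (rule ccontr)
    assume "\<not> \<bar>x i\<bar> < 3"
    then have "3 * 3 \<le> x i * x i" by (intro ge) auto
    then show False using qi sJ by (simp add: Q_def)
      (smt (verit) zero_le_square)
  qed
  have nz: "x i \<noteq> 0" "y i \<noteq> 0" using i(2) by auto
  have y1: "\<bar>y i\<bar> = 1" using yi nz(2) by arith
  have zero: "x j = 0 \<and> y j = 0" if "Q j = 0" for j
    using that by (simp add: Q_def add_nonneg_eq_0_iff)
  \<comment> \<open>A term 2 + sqrt 3 would use up the whole 7 and leave the mixed product 2 instead
    of 1.\<close>
  have xi2: "\<bar>x i\<bar> \<noteq> 2"
  proof
    assume x2: "\<bar>x i\<bar> = 2"
    have "x i = 2 \<or> x i = - 2" "y i = 1 \<or> y i = - 1" using x2 y1 by arith+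
    then have "x i * x i = 4" "y i * y i = 1" by auto
    then have "sum Q J = 0" using qi by (simp add: Q_def)
    then have "Q j = 0" if "j \<in> J" for j using le[OF that] Q0[of j] by simp
    then have "(\<Sum>j\<in>J. x j * y j) = 0" using zero by (intro sum.neutral) auto
    then have "x i * y i = 1" using pi by simp
    then show False using x2 by (auto simp: zmult_eq_1_iff)
  qed
  have "\<bar>x i\<bar> = 1" using xi xi2 nz(1) by arith
  then have xy: "x i = y i" "\<bar>y i\<bar> = 1"
    using y1 i(2) by (auto simp: abs_if split: if_splits)
  then have "y i = 1 \<or> y i = - 1" by arith
  then have "x i * x i = 1" "y i * y i = 1" using xy(1) by auto
  then have sum3: "sum Q J = 3" using qi by (simp add: Q_def)
  show ?thesis
  \<comment> \<open>The remaining 3 is either a single square of sqrt 3 or made of three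
    units.\<close>
  proof (cases "\<exists>k\<in>J. y k \<noteq> 0")
    case True
    then obtain k where k: "k \<in> J" "y k \<noteq> 0" by blast
    have "1 \<le> y k * y k" using ge[of 1 "y k"] k(2) by linarith
    moreover have "x k * x k + 3 * (y k * y k) \<le> 3" using le[OF k(1)] sum3 by (simp add: Q_def)
    ultimately have "x k * x k = 0" "y k * y k = 1" using zero_le_square[of "x k"] by linarith+
    then have k': "x k = 0" "y k * y k = 1" by auto
    then have yk: "\<bar>y k\<bar> = 1" by (auto simp: zmult_eq_1_iff)
    have "Q k + sum Q (J - {k}) = 3" using sum3 sum.remove[OF J(1) k(1), of Q] by simp
    then have s0: "sum Q (J - {k}) = 0" using k' by (simp add: Q_def)
    have "x j = 0 \<and> y j = 0" if "j \<in> J - {k}" for j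
    proof -
      have "Q j \<le> sum Q (J - {k})" using member_le_sum[OF that Q0] J(1) by simp
      then show ?thesis using s0 zero Q0[of j] by simp
    qed
    then have "\<forall>j\<in>I - {i, k}. x j = 0 \<and> y j = 0" by (auto simp: J_def)
    moreover have "k \<in> I" "i \<noteq> k" using k(1) by (auto simp: J_def)
    ultimately show ?thesis using that[of i k "y i"] i(1) k'(1) yk xy by simp
  next
    case False
    then have y0: "y j = 0" if "j \<in> J" for j using that by blast
    have xj: "\<bar>x j\<bar> \<le> 1" if "j \<in> J" for j
    proof (rule ccontr)
      assume "\<not> \<bar>x j\<bar> \<le> 1"
      then have "2 * 2 \<le> x j * x j" by (intro ge) auto
      then show False using le[OF that] sum3 zero_le_square[of "y j"] by (simp add: Q_def)
    qed
    have "Q j = (if x j = 0 then 0 else 1)" if "j \<in> J" for j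
    proof -
      have "x j = 0 \<or> x j = 1 \<or> x j = - 1" using xj[OF that] by arith
      then show ?thesis using y0[OF that] by (auto simp: Q_def)
    qed
    then have "sum Q J = (\<Sum>j\<in>J. if x j = 0 then 0 else 1)" by (intro sum.cong) auto
    also have "\<dots> = int (card {j\<in>J. x j \<noteq> 0})"
      using J(1) by (simp add: sum.If_cases Int_def)
    also have "{j\<in>J. x j \<noteq> 0} = J - {j\<in>J. x j = 0}" by auto
    finally have "card (J - {j\<in>J. x j = 0}) = 3" using sum3 by simp
    then have "card {j\<in>J. x j = 0} = 1"
      using J card_Diff_subset[of "{j\<in>J. x j = 0}" J] card_mono[of J "{j\<in>J. x j = 0}"] by simp
    then obtain k where k: "{j\<in>J. x j = 0} = {k}" by (auto simp: card_1_singleton_iff)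
    then have kJ: "k \<in> J" "x k = 0" by auto
    then have kI: "k \<in> I" "i \<noteq> k" using J(3) by (auto simp: J_def)
    have "\<bar>x j\<bar> = 1 \<and> y j = 0" if "j \<in> J - {k}" for j
    proof -
      have "x j \<noteq> 0" using that k by auto
      then show ?thesis using xj[of j] y0[of j] that by auto
    qed
    then have ones: "\<forall>j\<in>I - {i, k}. \<bar>x j\<bar> = 1 \<and> y j = 0" by (auto simp: J_def)
    show ?thesis using that[of i k "y i"] i(1) xy y0 kJ ones kI by simp
  qed
qed

text \<open>Both \<open>b\<close> and \<open>d\<close> have one of the two shapes of
  \<open>seven_two_decomposition\<close>. None of the four combinations has inner product 2 + sqrt
  3: two vectors of the first shape fail already modulo 2, the others by evaluating the few possible
  entries.\<close>

lemma form_not_sum_of_five_squares: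
  fixes b d :: "'a \<Rightarrow> zsqrt3"
  assumes fin: "finite I" and card: "card I = 5"
    and bb: "(\<Sum>j\<in>I. b j * b j) = Z3 7 2" and dd: "(\<Sum>j\<in>I. d j * d j) = Z3 7 2"
    and bd: "(\<Sum>j\<in>I. b j * d j) = Z3 2 1"
  shows False
proof -
  \<comment> \<open>Changing the signs of \<open>b j\<close> and \<open>d j\<close> together
    preserves all three Gram sums. It is used to make \<open>x j + y j\<close> nonnegative, so that
    every entry of \<open>b\<close> is known exactly and signs remain only in
    \<open>d\<close>.\<close>
  define u :: "'a \<Rightarrow> int" where "u = (\<lambda>j. if rpart (b j) + spart (b j) < 0 then - 1 else 1)"
  define x where "x = (\<lambda>j. u j * rpart (b j))"
  define y where "y = (\<lambda>j. u j * spart (b j))"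
  define v where "v = (\<lambda>j. u j * rpart (d j))"
  define w where "w = (\<lambda>j. u j * spart (d j))"
  have prods: "x j * x j = rpart (b j) * rpart (b j)" "y j * y j = spart (b j) * spart (b j)"
    "x j * y j = rpart (b j) * spart (b j)"
    "v j * v j = rpart (d j) * rpart (d j)" "w j * w j = spart (d j) * spart (d j)"
    "v j * w j = rpart (d j) * spart (d j)"
    "x j * v j = rpart (b j) * rpart (d j)" "y j * w j = spart (b j) * spart (d j)"
    "x j * w j = rpart (b j) * spart (d j)" "y j * v j = spart (b j) * rpart (d j)" for j
    by (simp_all add: x_def y_def v_def w_def u_def)
  have qb: "(\<Sum>j\<in>I. x j * x j + 3 * (y j * y j)) = 7" and qd: "(\<Sum>j\<in>I. v j * v j + 3 * (w j * w j)) = 7"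
    using arg_cong[OF bb, of rpart] arg_cong[OF dd, of rpart] by (simp_all add: prods rpart_sum)
  have pb: "(\<Sum>j\<in>I. x j * y j) = 1" and pd: "(\<Sum>j\<in>I. v j * w j) = 1"
    using arg_cong[OF bb, of spart] arg_cong[OF dd, of spart]
    by (simp_all add: prods spart_sum sum_distrib_left[symmetric])
  have r: "(\<Sum>j\<in>I. x j * v j + 3 * (y j * w j)) = 2" and s: "(\<Sum>j\<in>I. x j * w j + y j * v j) = 1"
    using arg_cong[OF bd, of rpart] arg_cong[OF bd, of spart]
    by (simp_all add: prods rpart_sum spart_sum)
  obtain i k e where b: "i \<in> I" "k \<in> I" "i \<noteq> k" "x i = e" "y i = e" "\<bar>e\<bar> = 1"
    "x k = 0 \<and> y k = 0 \<and> (\<forall>j\<in>I - {i, k}. \<bar>x j\<bar> = 1 \<and> y j = 0) \<or>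
     x k = 0 \<and> \<bar>y k\<bar> = 1 \<and> (\<forall>j\<in>I - {i, k}. x j = 0 \<and> y j = 0)"
    using seven_two_decomposition[OF fin card qb pb] by metis
  obtain i' k' e' where d: "i' \<in> I" "k' \<in> I" "i' \<noteq> k'" "v i' = e'" "w i' = e'" "\<bar>e'\<bar> = 1"
    "v k' = 0 \<and> w k' = 0 \<and> (\<forall>j\<in>I - {i', k'}. \<bar>v j\<bar> = 1 \<and> w j = 0) \<or>
     v k' = 0 \<and> \<bar>w k'\<bar> = 1 \<and> (\<forall>j\<in>I - {i', k'}. v j = 0 \<and> w j = 0)"
    using seven_two_decomposition[OF fin card qd pd] by metis
  have nonneg: "0 \<le> x j + y j" for j
    by (simp add: x_def y_def u_def)
  have "e = 1" using nonneg[of i] b(4-6) by arith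
  then have e: "x i = 1" "y i = 1" using b(4,5) by simp_all
  have "card (I - {i, k}) = 3" using fin card b(1-3) by (simp add: card_Diff_subset)
  then obtain l m n where lmn: "I - {i, k} = {l, m, n}" "l \<noteq> m" "l \<noteq> n" "m \<noteq> n"
    by (auto simp: card_3_iff)
  have "I = insert i (insert k (I - {i, k}))" using b(1,2) by blast
  then have I: "I = {i, k, l, m, n}" unfolding lmn(1) .
  have "l \<in> I - {i, k}" "m \<in> I - {i, k}" "n \<in> I - {i, k}" unfolding lmn(1) by simp_all
  then have dist: "l \<noteq> i" "l \<noteq> k" "m \<noteq> i" "m \<noteq> k" "n \<noteq> i" "n \<noteq> k"
    by simp_all
  have expand: "(\<Sum>j\<in>I. f j) = f i + f k + f l + f m + f n" for f :: "'a \<Rightarrow> int"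
    unfolding I using b(3) lmn(2-4) dist by simp
  have abs1: "a = 1 \<or> a = - 1" if "\<bar>a\<bar> = 1" for a :: int using that by arith
  show False
    using b(7)
  proof (elim disjE conjE)
    assume A: "x k = 0" "y k = 0" "\<forall>j\<in>I - {i, k}. \<bar>x j\<bar> = 1 \<and> y j = 0"
    have ones: "x l = 1" "x m = 1" "x n = 1" "y l = 0" "y m = 0" "y n = 0"
    proof -
      have "x j = 1 \<and> y j = 0" if "j \<in> {l, m, n}" for j
      proof -
        have "\<bar>x j\<bar> = 1" "y j = 0" using A(3) that unfolding lmn(1) by blast+
        moreover have "0 \<le> x j" using nonneg[of j] \<open>y j = 0\<close> by simp
        ultimately show ?thesis by simp
      qed
      then show "x l = 1" "x m = 1" "x n = 1" "y l = 0" "y m = 0" "y n = 0" by auto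
    qed
    have r': "v i + 3 * w i + v l + v m + v n = 2" and s': "v i + w i + w l + w m + w n = 1"
      using r s by (simp_all add: expand e A(1,2) ones)
    have mem: "i' \<in> {i, k, l, m, n}" "k' \<in> {i, k, l, m, n}" using d(1,2) unfolding I .
    note dist' = b(3) b(3)[symmetric] lmn(2-4) lmn(2-4)[symmetric] dist dist[symmetric]
    have inI: "i \<in> I" "l \<in> I" "m \<in> I" "n \<in> I" unfolding I by simp_all
    have parity: "even (v i + w i + v l + v m + v n)" "odd (v i + w i + w l + w m + w n)"
      using arg_cong[OF r', of even] arg_cong[OF s', of even] by simp_all
    show False
      using d(7)
    proof (elim disjE conjE)
      assume dA: "v k' = 0" "w k' = 0" "\<forall>j\<in>I - {i', k'}. \<bar>v j\<bar> = 1 \<and> w j = 0"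
      \<comment> \<open>Modulo 2 the signs of \<open>d\<close> disappear and only the positions
        \<open>i'\<close> and \<open>k'\<close> matter. The first parity condition then requires
        exactly one of \<open>k' = k\<close> and \<open>i' = i\<close>, and in either case the
        second sum is even.\<close>
      have "odd (v j) \<longleftrightarrow> j \<noteq> k'" "odd (w j) \<longleftrightarrow> j = i'" if jI: "j \<in> I" for j
      proof -
        consider "j = i'" | "j = k'" | "j \<in> I - {i', k'}" using jI by blast
        then have "(odd (v j) \<longleftrightarrow> j \<noteq> k') \<and> (odd (w j) \<longleftrightarrow> j = i')"
        proof cases
          case 1
          then show ?thesis using d(3-5) abs1[OF d(6)] by auto
        next
          case 2
          then show ?thesis using dA(1,2) d(3) by auto
        next
          case 3
          then have "w j = 0" "v j = 1 \<or> v j = - 1" using dA(3) abs1 by blast+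
          then show ?thesis using 3 by auto
        qed
        then show "odd (v j) \<longleftrightarrow> j \<noteq> k'" "odd (w j) \<longleftrightarrow> j = i'" by blast+
      qed
      then show False
        using parity mem d(3) dist' inI by auto
    next
      assume dB: "v k' = 0" "\<bar>w k'\<bar> = 1" "\<forall>j\<in>I - {i', k'}. v j = 0 \<and> w j = 0"
      have val: "v j = 0 \<and> w j = 0 \<or> v j = e' \<and> w j = e' \<or> v j = 0 \<and> w j = w k'"
        if "j \<in> I" for j
        using dB(1,3) d(4,5) that by blast
      have rest: "(\<Sum>j\<in>I - {i', k'}. v j) = 0" "(\<Sum>j\<in>I - {i', k'}. w j) = 0"
        using dB(3) by (simp_all add: sum.neutral)
      \<comment> \<open>The equations \<open>r'\<close> and \<open>s'\<close> run over all indices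
        except \<open>k\<close>. Subtracting them from these totals eliminates \<open>l\<close>,
        \<open>m\<close>, \<open>n\<close> and leaves only the entries at \<open>i\<close> and
        \<open>k\<close>.\<close>
      have "(\<Sum>j\<in>I. v j) = e'" "(\<Sum>j\<in>I. w j) = e' + w k'"
        using sum.subset_diff[of "{i', k'}" I v] sum.subset_diff[of "{i', k'}" I w] rest fin d(1-5) dB(1)
        by simp_all
      then have "v i + v k + v l + v m + v n = e'" "w i + w k + w l + w m + w n = e' + w k'"
        by (simp_all add: expand)
      then show False
        using r' s' val[OF b(1)] val[OF b(2)] abs1[OF d(6)] abs1[OF dB(2)] by arith
    qed
  next
    assume B: "x k = 0" "\<bar>y k\<bar> = 1" "\<forall>j\<in>I - {i, k}. x j = 0 \<and> y j = 0"
    have yk: "y k = 1" using B(1,2) nonneg[of k] by auto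
    have r': "v i + 3 * w i + 3 * w k = 2" and s': "v i + w i + v k = 1"
      using r s B lmn(1) by (simp_all add: expand e yk)
    have val: "(v j = 0 \<or> v j = 1 \<or> v j = - 1) \<and> (w j = 0 \<or> w j = 1 \<or> w j = - 1) \<and>
      (v j = w j \<or> v j = 0 \<or> w j = 0)" if "j \<in> I" for j
    proof (cases "j = i' \<or> j = k'")
      case True
      then show ?thesis using d(4,5,7) abs1[OF d(6)] abs1[of "w k'"] by (elim disjE) simp_all
    next
      case False
      then have "j \<in> I - {i', k'}" using that by blast
      then show ?thesis using d(7) abs1[of "v j"] by (elim disjE) simp_all
    qed
    show False
      using val[OF b(1)] val[OF b(2)] r' s' by (elim conjE disjE) simp_all
  qed
qed

lemma emb_numerals [simp]:
  "emb (numeral k) = numeral k" "emb (of_nat m) = real m" "emb' (numeral k) = numeral k"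
  by (simp_all add: emb_def emb'_def)

text \<open>\<open>A\<close>, \<open>B\<close>, \<open>C\<close> are the Gram entries of a binary
  form, and \<open>b i\<close>, \<open>d i\<close> are the coefficients of the i-th linear form
  whose square is taken.\<close>

definition needs_six_squares :: "zsqrt3 \<Rightarrow> zsqrt3 \<Rightarrow> zsqrt3 \<Rightarrow> bool" where
  "needs_six_squares A B C \<longleftrightarrow>
    (\<exists>b d. (\<Sum>i<6::nat. b i * b i) = A \<and> (\<Sum>i<6::nat. b i * d i) = B \<and> (\<Sum>i<6::nat. d i * d i) = C) \<and>
    \<not> (\<exists>b d. (\<Sum>i<5::nat. b i * b i) = A \<and> (\<Sum>i<5::nat. b i * d i) = B \<and> (\<Sum>i<5::nat. d i * d i) = C)"

lemma needs_six_squares_7_2: "needs_six_squares (Z3 7 2) (Z3 2 1) (Z3 7 2)"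
proof -
  \<comment> \<open>Both vectors realise 7 + 2 sqrt 3 as (1 + sqrt 3)^2 + 1 + 1 + 1. Their supports
    meet only in the first two places, which together give 2 + sqrt 3.\<close>
  define b :: "nat \<Rightarrow> zsqrt3" where "b i = [Z3 1 1, 1, 1, 1, 0, 0] ! i" for i
  define d :: "nat \<Rightarrow> zsqrt3" where "d i = [1, 1, 0, 0, Z3 1 1, 1] ! i" for i
  have "(\<Sum>i<6. b i * b i) = Z3 7 2" "(\<Sum>i<6. b i * d i) = Z3 2 1" "(\<Sum>i<6. d i * d i) = Z3 7 2"
    by (simp_all add: numeral_eq_Suc lessThan_Suc b_def d_def zsqrt3_eq_iff)
  then show ?thesis
    using form_not_sum_of_five_squares[of "{..<5::nat}"] unfolding needs_six_squares_def by auto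
qed

text \<open>The squares of the complex numbers f + i g sum to zero, so the modulus of one of them is
  at most the sum of the other moduli.\<close>

lemma isotropic_norm_bound:
  fixes f g :: "'a \<Rightarrow> real"
  assumes fin: "finite I" and j: "j \<in> I"
    and "(\<Sum>i\<in>I. (f i)\<^sup>2 - (g i)\<^sup>2) = 0" "(\<Sum>i\<in>I. f i * g i) = 0"
  shows "2 * ((f j)\<^sup>2 + (g j)\<^sup>2) \<le> (\<Sum>i\<in>I. (f i)\<^sup>2 + (g i)\<^sup>2)"
proof -
  define c where "c i = (Complex (f i) (g i))\<^sup>2" for i
  have c: "c i = Complex ((f i)\<^sup>2 - (g i)\<^sup>2) (2 * (f i * g i))" for i
    by (simp add: c_def power2_eq_square complex_eq_iff)
  have cmod: "cmod (c i) = (f i)\<^sup>2 + (g i)\<^sup>2" for i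
    by (simp add: c_def norm_power cmod_power2)
  have "sum c I = 0"
    using assms(3,4) by (simp add: complex_eq_iff c sum_distrib_left[symmetric])
  then have "c j = - (\<Sum>i\<in>I - {j}. c i)"
    using sum.remove[OF fin j, of c] by (simp add: add_eq_0_iff2)
  then have "cmod (c j) \<le> (\<Sum>i\<in>I - {j}. cmod (c i))"
    by (simp add: norm_sum)
  then show ?thesis
    using sum.remove[OF fin j, of "\<lambda>i. cmod (c i)"] by (simp add: cmod)
qed

text \<open>With \<open>\<zeta>\<close> a primitive 12th root of unity, \<open>b\<^sup>2 - \<surd>3 b d + d\<^sup>2\<close> is the squared modulus of
  \<open>b - \<zeta> d\<close>, and the three equations say that the squares of these numbers sum to zero while their
  squared moduli sum to \<open>9 + 3\<surd>3\<close>. The triangle inequality in both embeddings leaves only the moduli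
  0, 1 and \<open>2 + \<surd>3\<close>, which forces three of each nonzero kind.\<close>

lemma needs_six_squares_18_6: "needs_six_squares (Z3 18 6) (Z3 9 9) (Z3 18 6)"
proof -
  define b :: "nat \<Rightarrow> zsqrt3" where "b i = [1, - 1, - 2, 1, Z3 (- 1) (- 1), Z3 (- 2) (- 1)] ! i" for i
  define d :: "nat \<Rightarrow> zsqrt3" where "d i = [0, Z3 0 (- 1), Z3 0 (- 1), - 1, Z3 (- 2) (- 1), Z3 (- 1) (- 1)] ! i" for i
  have "(\<Sum>i<6. b i * b i) = Z3 18 6" "(\<Sum>i<6. b i * d i) = Z3 9 9" "(\<Sum>i<6. d i * d i) = Z3 18 6"
    by (simp_all add: numeral_eq_Suc lessThan_Suc b_def d_def zsqrt3_eq_iff)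
  moreover have False
    if bb: "(\<Sum>i<5. b i * b i) = Z3 18 6" and bd: "(\<Sum>i<5. b i * d i) = Z3 9 9"
      and dd: "(\<Sum>i<5. d i * d i) = Z3 18 6" for b d :: "nat \<Rightarrow> zsqrt3"
  proof -
    define q where "q i = b i * b i - Z3 0 1 * (b i * d i) + d i * d i" for i
    have sum_q: "(\<Sum>i<5. q i) = Z3 9 3"
      unfolding q_def sum.distrib sum_subtractf sum_distrib_left[symmetric] bb bd dd
      by (simp add: zsqrt3_eq_iff)
    \<comment> \<open>The parameter \<open>w\<close> is the image of sqrt 3 under \<open>h\<close>;
      one computation serves both embeddings.\<close>
    have embedding: "0 \<le> h (q j) \<and> 2 * h (q j) \<le> h (Z3 9 3)"
      if j: "j < 5" and w: "w * w = 3" and h: "\<And>x y. h (x + y) = h x + h y" "\<And>x y. h (x - y) = h x - h y"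
        "\<And>x y. h (x * y) = h x * h y" "\<And>m n. h (Z3 m n) = of_int m + of_int n * w"
      for h :: "zsqrt3 \<Rightarrow> real" and w j
    proof -
      have ww: "w * (w * x) = 3 * x" for x by (simp add: w mult.assoc[symmetric])
      have h0: "h 0 = 0" using h(2)[of 0 0] by simp
      have h_sum: "h (sum u A) = (\<Sum>i\<in>A. h (u i))" for u :: "nat \<Rightarrow> zsqrt3" and A
        by (induction A rule: infinite_finite_induct) (simp_all add: h0 h(1))
      \<comment> \<open>For \<zeta> = (w + i) / 2, a primitive 12th root of unity for either sign of
        \<open>w\<close>, these are the real and imaginary parts of h(b) minus the conjugate of
        \<zeta> times h(d).\<close>
      define f where "f i = h (b i) - w / 2 * h (d i)" for i
      define g where "g i = h (d i) / 2" for i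
      have hq: "h (q i) = (f i)\<^sup>2 + (g i)\<^sup>2" for i
      proof -
        have "(f i)\<^sup>2 + (g i)\<^sup>2 = h (b i) * h (b i) - w * (h (b i) * h (d i)) + (w * w + 1) / 4 * (h (d i) * h (d i))"
          by (simp add: f_def g_def power2_eq_square field_simps)
        then show ?thesis by (simp add: q_def h w)
      qed
      have "(f i)\<^sup>2 - (g i)\<^sup>2 = h (b i) * h (b i) - w * (h (b i) * h (d i)) + (w * w - 1) / 4 * (h (d i) * h (d i))" for i
        by (simp add: f_def g_def power2_eq_square field_simps)
      then have "(\<Sum>i<5. (f i)\<^sup>2 - (g i)\<^sup>2) = h (\<Sum>i<5. b i * b i) - w * h (\<Sum>i<5. b i * d i) + h (\<Sum>i<5. d i * d i) / 2"
        by (simp add: w h_sum h(3) sum.distrib sum_subtractf sum_distrib_left[symmetric] sum_divide_distrib[symmetric])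
      also have "\<dots> = 0"
        unfolding bb bd dd h(4) by (simp add: field_simps ww)
      finally have re: "(\<Sum>i<5. (f i)\<^sup>2 - (g i)\<^sup>2) = 0" .
      have "f i * g i = (h (b i) * h (d i)) / 2 - w / 4 * (h (d i) * h (d i))" for i
        by (simp add: f_def g_def field_simps)
      then have "(\<Sum>i<5. f i * g i) = h (\<Sum>i<5. b i * d i) / 2 - w / 4 * h (\<Sum>i<5. d i * d i)"
        by (simp only: h_sum h(3) sum_subtractf sum_distrib_left[symmetric] sum_divide_distrib[symmetric])
      also have "\<dots> = 0"
        unfolding bd dd h(4) by (simp add: field_simps ww)
      finally have im: "(\<Sum>i<5. f i * g i) = 0" .
      have "2 * h (q j) \<le> (\<Sum>i<5. h (q i))"
        using isotropic_norm_bound[OF _ _ re im, of j] j by (simp add: hq)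
      moreover have "(\<Sum>i<5. h (q i)) = h (Z3 9 3)" by (simp only: h_sum[symmetric] sum_q)
      moreover have "0 \<le> h (q j)" by (simp add: hq)
      ultimately show ?thesis by simp
    qed
    \<comment> \<open>The functional \<open>rpart - spart\<close> takes the values 0, 1, 1 at 0, 1
      and 2 + sqrt 3, but 6 at the total 9 + 3 sqrt 3. Five terms therefore cannot reach the
      total.\<close>
    have small: "rpart (q j) - spart (q j) \<le> 1" if j: "j < 5" for j
    proof -
      have "0 \<le> emb (q j) \<and> 2 * emb (q j) \<le> emb (Z3 9 3)"
        by (rule embedding[OF j, of "sqrt 3"]) (simp_all add: emb_def algebra_simps)
      moreover have "0 \<le> emb' (q j) \<and> 2 * emb' (q j) \<le> emb' (Z3 9 3)"
        by (rule embedding[OF j, of "- sqrt 3"]) (simp_all add: emb'_def algebra_simps)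
      ultimately have "totally_nonneg (q j)" "totally_nonneg (Z3 9 3 - (q j + q j))"
        by (simp_all add: totally_nonneg_def)
      note bounds = totally_nonnegD[OF this(1)] totally_nonnegD[OF this(2)]
      define m where "m = rpart (q j)"
      define n where "n = spart (q j)"
      have mn: "0 \<le> m" "3 * n\<^sup>2 \<le> m\<^sup>2" "2 * m \<le> 9" "3 * (3 - 2 * n)\<^sup>2 \<le> (9 - 2 * m)\<^sup>2"
        using bounds by (simp_all add: m_def n_def algebra_simps)
      have m: "m \<in> {0, 1, 2, 3, 4}" using mn(1,3) by auto
      have "m\<^sup>2 \<le> 4\<^sup>2" using m by (intro power_mono) auto
      then have "n\<^sup>2 < 3\<^sup>2" using mn(2) by simp
      then have "\<bar>n\<bar> < 3" by (metis abs_le_square_iff abs_numeral linorder_not_less)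
      then have n: "n \<in> {- 2, - 1, 0, 1, 2}" by auto
      have cases: "m = 0 \<and> n = 0 \<or> m = 1 \<and> n = 0 \<or> m = 2 \<and> n = 1 \<or> m = 3 \<and> n = 1"
        using m n mn(2,4) by (elim insertE emptyE; simp)
      \<comment> \<open>The value 3 + sqrt 3 survives the size bounds and has to be excluded
        arithmetically. Modulo the prime sqrt 3 the form becomes a sum of two squares, anisotropic
        over the field with three elements, so a value divisible by sqrt 3 is divisible by 3; this
        one is not.\<close>
      have "\<not> (m = 3 \<and> n = 1)"
      proof
        assume "m = 3 \<and> n = 1"
        moreover obtain x y x' y' where "b j = Z3 x y" "d j = Z3 x' y'" by (metis zsqrt3.exhaust)
        ultimately have eq: "x * x + x' * x' = 3 * (1 - y * y - y' * y' + x * y' + y * x')"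
          "2 * (x * y) + 2 * (x' * y') - x * x' - 3 * (y * y') = 1"
          by (simp_all add: m_def n_def q_def algebra_simps)
        have res: "z mod 3 = 0 \<and> z * z mod 3 = 0 \<or> z * z mod 3 = 1" for z :: int
        proof -
          have "z mod 3 = 0 \<or> z mod 3 = 1 \<or> z mod 3 = 2" by presburger
          then show ?thesis using mod_mult_eq[of z 3 z] by auto
        qed
        have "(x * x + x' * x') mod 3 = 0" unfolding eq(1) by simp
        then have "(x * x mod 3 + x' * x' mod 3) mod 3 = 0" by (simp add: mod_add_eq)
        then have "x mod 3 = 0" "x' mod 3 = 0" using res[of x] res[of x'] by auto
        then obtain z z' where "x = 3 * z" "x' = 3 * z'" by (metis mod_0_imp_dvd dvdE)
        then have "3 * (2 * (z * y) + 2 * (z' * y') - 3 * (z * z') - y * y') = 1"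
          using eq(2) by (simp add: algebra_simps)
        then show False by presburger
      qed
      then show ?thesis using cases unfolding m_def n_def by auto
    qed
    have "(\<Sum>i<5. rpart (q i) - spart (q i)) = 6"
      using arg_cong[OF sum_q, of rpart] arg_cong[OF sum_q, of spart]
      by (simp add: rpart_sum spart_sum sum_subtractf)
    moreover have "(\<Sum>i<5. rpart (q i) - spart (q i)) \<le> (\<Sum>i<5::nat. 1)"
      by (intro sum_mono small) simp
    ultimately show False by simp
  qed
  ultimately show ?thesis unfolding needs_six_squares_def by blast
qed

section \<open>Quadratic orders\<close>

definition lin_comb :: "real \<Rightarrow> zsqrt3 \<Rightarrow> zsqrt3 \<Rightarrow> real" where
  "lin_comb \<omega> d b = emb d + emb b * \<omega>"

text \<open>The symmetric bilinear form with Gram entries \<open>A\<close>, \<open>B\<close>,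
  \<open>C\<close>, taken at the vectors (p, q) and (r, t).\<close>

definition form_bilin ::
    "zsqrt3 \<Rightarrow> zsqrt3 \<Rightarrow> zsqrt3 \<Rightarrow> zsqrt3 \<Rightarrow> zsqrt3 \<Rightarrow> zsqrt3 \<Rightarrow> zsqrt3 \<Rightarrow> zsqrt3" where
  "form_bilin A B C p q r t = A * (p * r) + B * (p * t + q * r) + C * (q * t)"

lemma bilin_sum:
  fixes b d :: "'a \<Rightarrow> 'b :: comm_ring_1"
  shows "(\<Sum>i\<in>I. (p * b i + q * d i) * (r * b i + t * d i)) =
    (p * r) * (\<Sum>i\<in>I. b i * b i) + (p * t + q * r) * (\<Sum>i\<in>I. b i * d i) + (q * t) * (\<Sum>i\<in>I. d i * d i)"
proof -
  have "(\<Sum>i\<in>I. (p * b i + q * d i) * (r * b i + t * d i)) =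
      (\<Sum>i\<in>I. (p * r) * (b i * b i) + (p * t + q * r) * (b i * d i) + (q * t) * (d i * d i))"
    by (intro sum.cong refl) (simp only: algebra_simps)
  then show ?thesis
    by (simp only: sum.distrib sum_distrib_left)
qed

lemma form_bilin_sum:
  assumes "(\<Sum>i\<in>I. b i * b i) = A" "(\<Sum>i\<in>I. b i * d i) = B" "(\<Sum>i\<in>I. d i * d i) = C"
  shows "(\<Sum>i\<in>I. (p * b i + q * d i) * (r * b i + t * d i)) = form_bilin A B C p q r t"
  by (simp only: bilin_sum assms form_bilin_def mult.commute)

text \<open>Only two combinations of the three Gram sums enter the value, so the value alone
  determines the Gram matrix up to one parameter.\<close>

lemma sum_lin_comb_squares:
  assumes sq: "\<omega> * \<omega> = emb \<tau> * \<omega> + emb \<nu>"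
  shows "(\<Sum>i\<in>I. lin_comb \<omega> (d i) (b i) * lin_comb \<omega> (d i) (b i)) =
    lin_comb \<omega> ((\<Sum>i\<in>I. d i * d i) + \<nu> * (\<Sum>i\<in>I. b i * b i))
      (2 * (\<Sum>i\<in>I. b i * d i) + \<tau> * (\<Sum>i\<in>I. b i * b i))"
proof -
  have two: "emb 2 = 2" by (simp add: emb_def)
  have "lin_comb \<omega> (d i) (b i) * lin_comb \<omega> (d i) (b i) =
      emb (d i) * emb (d i) + 2 * (emb (b i) * emb (d i)) * \<omega> + (emb (b i) * emb (b i)) * (\<omega> * \<omega>)" for i
    by (simp add: lin_comb_def algebra_simps)
  then have "(\<Sum>i\<in>I. lin_comb \<omega> (d i) (b i) * lin_comb \<omega> (d i) (b i)) =
      (\<Sum>i\<in>I. emb (d i) * emb (d i)) + 2 * (\<Sum>i\<in>I. emb (b i) * emb (d i)) * \<omega> +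
      (\<Sum>i\<in>I. emb (b i) * emb (b i)) * (\<omega> * \<omega>)"
    by (simp only: sum.distrib sum_distrib_left sum_distrib_right)
  then show ?thesis
    by (simp add: lin_comb_def emb_sum sq two algebra_simps)
qed

text \<open>The closure hypotheses make the record an additive monoid, which is enough to identify
  \<open>finsum\<close> with the ordinary sum. Excluding exactly \<open>m\<close> squares suffices,
  because a shorter sum can be padded with zeros.\<close>

lemma pythagoras_number_ge:
  fixes K :: "real set"
  defines "R \<equiv> ring_of_integers K"
  assumes zero: "0 \<in> carrier R" and plus: "\<And>x y. x \<in> carrier R \<Longrightarrow> y \<in> carrier R \<Longrightarrow> x + y \<in> carrier R"
    and mult: "\<And>x y. x \<in> carrier R \<Longrightarrow> y \<in> carrier R \<Longrightarrow> x * y \<in> carrier R"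
    and f: "f \<in> {..<Suc m} \<rightarrow> carrier R"
    and short: "\<And>g. g \<in> {..<m} \<rightarrow> carrier R \<Longrightarrow> (\<Sum>i<Suc m. f i * f i) \<noteq> (\<Sum>i<m. g i * g i)"
  shows "enat (Suc m) \<le> pythagoras_number R"
proof -
  have ops [simp]: "x \<oplus>\<^bsub>R\<^esub> y = x + y" "x \<otimes>\<^bsub>R\<^esub> y = x * y" "\<zero>\<^bsub>R\<^esub> = 0" "\<one>\<^bsub>R\<^esub> = 1" for x y
    by (simp_all add: R_def ring_of_integers_def ring_of_type_algebra_def)
  interpret abelian_monoid R
    by (rule abelian_monoidI) (use zero plus in \<open>auto simp: algebra_simps\<close>)
  have pow: "x [^]\<^bsub>R\<^esub> (2::nat) = x * x" for x
    by (simp add: nat_pow_def numeral_2_eq_2)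
  have fin: "(\<Oplus>\<^bsub>R\<^esub>i\<in>{..<n}. g i [^]\<^bsub>R\<^esub> (2::nat)) = (\<Sum>i<n. g i * g i)"
    if "g \<in> {..<n} \<rightarrow> carrier R" for g and n :: nat
    using that
  proof (induction n)
    case 0
    then show ?case by simp
  next
    case (Suc n)
    have "g i * g i \<in> carrier R" if "i < Suc n" for i
      using Suc.prems that by (intro mult) auto
    then have "(\<Oplus>\<^bsub>R\<^esub>i\<in>{..<Suc n}. g i [^]\<^bsub>R\<^esub> (2::nat)) =
        g n [^]\<^bsub>R\<^esub> (2::nat) \<oplus>\<^bsub>R\<^esub> (\<Oplus>\<^bsub>R\<^esub>i\<in>{..<n}. g i [^]\<^bsub>R\<^esub> (2::nat))"
      unfolding lessThan_Suc by (intro finsum_insert) (simp_all add: pow Pi_iff)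
    moreover have "g \<in> {..<n} \<rightarrow> carrier R" using Suc.prems by auto
    ultimately show ?case using Suc.IH by (simp add: pow)
  qed
  have iff: "is_sum_of_n_squares R n a \<longleftrightarrow> (\<exists>g \<in> {..<n} \<rightarrow> carrier R. a = (\<Sum>i<n. g i * g i))" for n a
    unfolding is_sum_of_n_squares_def using fin by auto
  define a where "a = (\<Sum>i<Suc m. f i * f i)"
  have a: "is_sum_of_n_squares R (Suc m) a"
    unfolding iff a_def using f by blast
  have "Suc m \<le> sq_length R a"
  proof (rule ccontr)
    assume "\<not> Suc m \<le> sq_length R a"
    then have le: "sq_length R a \<le> m" by simp
    have "is_sum_of_n_squares R (sq_length R a) a"
      unfolding sq_length_def using a by (rule LeastI)
    then obtain g where g: "g \<in> {..<sq_length R a} \<rightarrow> carrier R" "a = (\<Sum>i<sq_length R a. g i * g i)"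
      unfolding iff by blast
    define h where "h i = (if i < sq_length R a then g i else 0)" for i
    have "(\<Sum>i<m. h i * h i) = (\<Sum>i<sq_length R a. g i * g i)"
      using le by (intro sum.mono_neutral_cong_right) (auto simp: h_def)
    moreover have "h \<in> {..<m} \<rightarrow> carrier R" using g(1) zero by (auto simp: h_def)
    ultimately show False using short[of h] g(2) by (simp add: a_def)
  qed
  moreover have "enat (sq_length R a) \<le> pythagoras_number R"
    unfolding pythagoras_number_def sums_of_squares_def using a by (intro SUP_upper) blast
  ultimately show ?thesis by (meson enat_ord_simps(1) order_trans)
qed

text \<open>The assumption \<open>par\<close> will show that the unknown change in the first Gram
  entry is divisible by 2. For odd \<open>s\<close> the equation decides this, since
  \<open>\<tau>\<close> is a unit modulo 2. For even \<open>s\<close> the trace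
  \<open>\<tau>\<close> is itself even, and the parities of the sqrt 3-coordinates decide it through
  \<open>\<nu>\<close>.\<close>

locale quadratic_order =
  fixes S :: "real set" and \<omega> :: real and \<tau> \<nu> :: zsqrt3
  assumes S_eq: "S = {lin_comb \<omega> d b | d b. True}"
    and indep: "lin_comb \<omega> d b = lin_comb \<omega> d' b' \<Longrightarrow> d = d' \<and> b = b'"
    and sq: "\<omega> * \<omega> = emb \<tau> * \<omega> + emb \<nu>"
    and par: "2 * u = \<tau> * t \<Longrightarrow> even (spart t) \<Longrightarrow> even (spart (\<nu> * t)) \<Longrightarrow> \<exists>z. t = 2 * z"
begin

lemma plus_closed: "x \<in> S \<Longrightarrow> y \<in> S \<Longrightarrow> x + y \<in> S"
proof -
  have "lin_comb \<omega> d b + lin_comb \<omega> d' b' = lin_comb \<omega> (d + d') (b + b')" for d b d' b'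
    by (simp add: lin_comb_def algebra_simps)
  then show "x \<in> S \<Longrightarrow> y \<in> S \<Longrightarrow> x + y \<in> S"
    unfolding S_eq by blast
qed

lemma mult_closed: "x \<in> S \<Longrightarrow> y \<in> S \<Longrightarrow> x * y \<in> S"
proof -
  have "lin_comb \<omega> d b * lin_comb \<omega> d' b' =
      emb d * emb d' + (emb d * emb b' + emb b * emb d') * \<omega> + emb b * emb b' * (\<omega> * \<omega>)" for d b d' b'
    by (simp add: lin_comb_def algebra_simps)
  then have "lin_comb \<omega> d b * lin_comb \<omega> d' b' =
      lin_comb \<omega> (d * d' + \<nu> * (b * b')) (d * b' + b * d' + \<tau> * (b * b'))" for d b d' b'
    by (simp add: lin_comb_def sq algebra_simps)
  then show "x \<in> S \<Longrightarrow> y \<in> S \<Longrightarrow> x * y \<in> S"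
    unfolding S_eq by blast
qed

lemma zero_mem: "0 \<in> S"
proof -
  have "0 = lin_comb \<omega> 0 0" by (simp add: lin_comb_def)
  then show ?thesis unfolding S_eq by blast
qed

text \<open>The assumption \<open>rigid\<close> says that no other value of the sum of the squared
  \<open>\<omega>\<close>-coordinates is compatible with the Cauchy--Schwarz inequality in both embeddings.\<close>

lemma length_six:
  fixes p q r t e A0 B0 C0 :: zsqrt3
  defines "\<beta> \<equiv> form_bilin A0 B0 C0 p q p q" and "\<gamma> \<equiv> form_bilin A0 B0 C0 r t r t"
    and "\<delta> \<equiv> form_bilin A0 B0 C0 p q r t"
  assumes form: "needs_six_squares A0 B0 C0" and unit: "e * (p * t - q * r) = 1"
    and rigid: "\<And>z. totally_nonneg (\<beta> * \<gamma> - \<delta> * \<delta> + 2 * (\<gamma> - \<nu> * \<beta> + \<delta> * \<tau>) * z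
      - (4 * \<nu> + \<tau> * \<tau>) * (z * z)) \<Longrightarrow> z = 0"
  shows "\<exists>f \<in> {..<6::nat} \<rightarrow> S. \<forall>g \<in> {..<5::nat} \<rightarrow> S. (\<Sum>i<6. f i * f i) \<noteq> (\<Sum>i<5. g i * g i)"
proof -
  obtain b6 d6 where six: "(\<Sum>i<6::nat. b6 i * b6 i) = A0" "(\<Sum>i<6::nat. b6 i * d6 i) = B0" "(\<Sum>i<6::nat. d6 i * d6 i) = C0"
    using form unfolding needs_six_squares_def by blast
  \<comment> \<open>Regrouped, this is the i-th linear form at the pair (p \<omega> + r, q \<omega>
    + t). The unit condition on the determinant makes the pair another basis of the order over
    \<int>[sqrt 3].\<close>
  define f where "f i = lin_comb \<omega> (r * b6 i + t * d6 i) (p * b6 i + q * d6 i)" for i :: nat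
  have f: "(\<Sum>i<6. f i * f i) = lin_comb \<omega> (\<gamma> + \<nu> * \<beta>) (2 * \<delta> + \<tau> * \<beta>)"
    unfolding f_def sum_lin_comb_squares[OF sq] form_bilin_sum[OF six] \<beta>_def \<gamma>_def \<delta>_def ..
  have even_form: "even (spart \<beta>)" "even (spart \<gamma>)"
    unfolding \<beta>_def \<gamma>_def form_bilin_sum[OF six, symmetric] by (simp_all add: spart_sum dvd_sum)
  have "f \<in> {..<6::nat} \<rightarrow> S" unfolding S_eq f_def by blast
  moreover have "(\<Sum>i<6. f i * f i) \<noteq> (\<Sum>i<5. g i * g i)" if g: "g \<in> {..<5::nat} \<rightarrow> S" for g
  proof
    assume eq: "(\<Sum>i<6. f i * f i) = (\<Sum>i<5. g i * g i)"
    have "\<forall>i\<in>{..<5}. \<exists>d b. g i = lin_comb \<omega> d b" using g unfolding S_eq by blast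
    then obtain d b where db: "\<And>i. i \<in> {..<5} \<Longrightarrow> g i = lin_comb \<omega> (d i) (b i)" by metis
    define B where "B = (\<Sum>i<5. b i * b i)"
    define D where "D = (\<Sum>i<5. d i * d i)"
    define P where "P = (\<Sum>i<5. b i * d i)"
    have "(\<Sum>i<5. g i * g i) = (\<Sum>i<5. lin_comb \<omega> (d i) (b i) * lin_comb \<omega> (d i) (b i))"
      using db by (intro sum.cong) auto
    also have "\<dots> = lin_comb \<omega> (D + \<nu> * B) (2 * P + \<tau> * B)"
      unfolding sum_lin_comb_squares[OF sq] B_def D_def P_def ..
    finally have eqs: "\<gamma> + \<nu> * \<beta> = D + \<nu> * B" "2 * \<delta> + \<tau> * \<beta> = 2 * P + \<tau> * B"
      using eq f indep by metis+
    \<comment> \<open>The sqrt 3-coordinate of a square is twice a product. The same holds for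
      \<open>\<beta>\<close> and \<open>\<gamma>\<close>, which are sums of squares as well.\<close>
    have even: "even (spart B)" "even (spart D)"
      by (simp_all add: B_def D_def spart_sum dvd_sum)
    have \<nu>: "\<nu> * (B - \<beta>) = \<gamma> - D" using eqs(1) by (simp only: algebra_simps)
    have \<tau>: "2 * (\<delta> - P) = \<tau> * (B - \<beta>)" using eqs(2) by (simp only: algebra_simps)
    obtain z where z: "B - \<beta> = 2 * z"
      using par[OF \<tau>] even even_form \<nu> by auto
    have Bz: "B = \<beta> + 2 * z" using z by (simp add: algebra_simps)
    have Dz: "D = \<gamma> - 2 * \<nu> * z" using \<nu> z by (simp add: algebra_simps)
    have "2 * (\<delta> - P) = 2 * (\<tau> * z)" using \<tau> z by (simp add: algebra_simps)
    then have Pz: "P = \<delta> - \<tau> * z" by (simp add: zsqrt3_eq_iff)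
    \<comment> \<open>The Gram determinant, rewritten in \<open>z\<close>, has leading coefficient
      minus the discriminant of \<open>\<omega>\<close>; this is where all large \<open>z\<close>
      are lost.\<close>
    have "totally_nonneg (B * D - P * P)"
      unfolding B_def D_def P_def by (rule totally_nonneg_Cauchy_Schwarz)
    also have "B * D - P * P = \<beta> * \<gamma> - \<delta> * \<delta> + 2 * (\<gamma> - \<nu> * \<beta> + \<delta> * \<tau>) * z
      - (4 * \<nu> + \<tau> * \<tau>) * (z * z)"
    proof -
      have "2 = (1 + 1 :: zsqrt3)" "4 = (1 + 1 + 1 + 1 :: zsqrt3)" by simp_all
      then show ?thesis unfolding Bz Dz Pz by (simp only: algebra_simps mult_1_left mult_1_right)
    qed
    finally have "z = 0" by (rule rigid)
    then have BDP: "B = \<beta>" "D = \<gamma>" "P = \<delta>" using Bz Dz Pz by simp_all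
    have det: "e * e * ((p * t - q * r) * (p * t - q * r)) * c = c" for c
    proof -
      have "e * e * ((p * t - q * r) * (p * t - q * r)) * c = (e * (p * t - q * r)) * (e * (p * t - q * r)) * c"
        by (simp only: mult_ac)
      then show ?thesis by (simp add: unit)
    qed
    \<comment> \<open>\<open>e\<close> times the adjugate inverts the change of basis. The five new
      linear forms have the original Gram entries \<open>A0\<close>, \<open>B0\<close>,
      \<open>C0\<close>, contradicting \<open>form\<close>.\<close>
    define b' where "b' i = e * t * b i + (- (e * q)) * d i" for i
    define d' where "d' i = (- (e * r)) * b i + e * p * d i" for i
    have "(\<Sum>i<5. b' i * b' i) = e * e * ((p * t - q * r) * (p * t - q * r)) * A0"
      "(\<Sum>i<5. d' i * d' i) = e * e * ((p * t - q * r) * (p * t - q * r)) * C0"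
      "(\<Sum>i<5. b' i * d' i) = e * e * ((p * t - q * r) * (p * t - q * r)) * B0"
      unfolding b'_def d'_def bilin_sum BDP[unfolded B_def D_def P_def]
      unfolding \<beta>_def \<gamma>_def \<delta>_def form_bilin_def by (simp_all add: algebra_simps)
    then show False
      using form unfolding needs_six_squares_def det by blast
  qed
  ultimately show ?thesis by blast
qed

lemma six_le_pythagoras_number:
  fixes p q r t e A0 B0 C0 :: zsqrt3
  defines "\<beta> \<equiv> form_bilin A0 B0 C0 p q p q" and "\<gamma> \<equiv> form_bilin A0 B0 C0 r t r t"
    and "\<delta> \<equiv> form_bilin A0 B0 C0 p q r t"
  assumes "carrier (ring_of_integers K) = S" "needs_six_squares A0 B0 C0" "e * (p * t - q * r) = 1"
    and "\<And>z. totally_nonneg (\<beta> * \<gamma> - \<delta> * \<delta> + 2 * (\<gamma> - \<nu> * \<beta> + \<delta> * \<tau>) * z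
      - (4 * \<nu> + \<tau> * \<tau>) * (z * z)) \<Longrightarrow> z = 0"
  shows "6 \<le> pythagoras_number (ring_of_integers K)"
proof -
  obtain f where f: "f \<in> {..<6::nat} \<rightarrow> S"
    "\<And>g. g \<in> {..<5::nat} \<rightarrow> S \<Longrightarrow> (\<Sum>i<6. f i * f i) \<noteq> (\<Sum>i<5. g i * g i)"
    using length_six[OF assms(5,6) assms(7)[unfolded \<beta>_def \<gamma>_def \<delta>_def]] by blast
  have "enat (Suc 5) \<le> pythagoras_number (ring_of_integers K)"
    by (rule pythagoras_number_ge[where f = f])
      (use f zero_mem plus_closed mult_closed in \<open>simp_all add: assms(4)\<close>)
  then show ?thesis by (simp add: numeral_eq_enat)
qed

end

section \<open>The ring of integers of the biquadratic field\<close>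

text \<open>In lowest terms the square of the denominator divides \<open>n\<close>.\<close>

lemma Rats_Ints_if_squarefree_mult_square:
  fixes n :: nat and x :: real
  assumes x: "x \<in> \<rat>" and n: "squarefree n" and int: "x\<^sup>2 * real n \<in> \<int>"
  shows "x \<in> \<int>"
proof -
  obtain a b :: nat where ab: "b \<noteq> 0" "\<bar>x\<bar> = real a / real b" "coprime a b"
    using Rats_abs_nat_div_natE[OF x] by metis
  obtain k where k: "x\<^sup>2 * real n = of_int k" using int by (elim Ints_cases)
  have "0 \<le> (of_int k :: real)" unfolding k[symmetric] by simp
  then have "0 \<le> k" by simp
  then obtain m where m: "k = int m" by (metis nonneg_int_cases)
  have x2: "x\<^sup>2 = (real a)\<^sup>2 / (real b)\<^sup>2"
    using arg_cong[OF ab(2), of "\<lambda>y. y\<^sup>2"] by (simp add: power_divide)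
  have "(real a)\<^sup>2 * real n = real m * (real b)\<^sup>2"
    using k ab(1) unfolding m x2 by (simp add: field_simps)
  then have "real (a\<^sup>2 * n) = real (m * b\<^sup>2)" by simp
  then have "a\<^sup>2 * n = m * b\<^sup>2" by (simp only: of_nat_eq_iff)
  then have "b\<^sup>2 dvd a\<^sup>2 * n" by simp
  moreover have "coprime (b\<^sup>2) (a\<^sup>2)" using ab(3) by (simp add: coprime_commute)
  ultimately have "b\<^sup>2 dvd n" by (simp add: coprime_dvd_mult_right_iff)
  then have "b = 1" using n by (auto simp: squarefree_def)
  then have "\<bar>x\<bar> \<in> \<int>" using ab(2) by simp
  then show ?thesis by (auto simp: abs_if split: if_splits)
qed

lemma sqrt_squarefree_irrational:
  fixes n :: nat
  assumes n: "squarefree n" "1 < n"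
  shows "sqrt (real n) \<notin> \<rat>"
proof
  assume q: "sqrt (real n) \<in> \<rat>"
  have "(sqrt (real n) / real n)\<^sup>2 * real n = 1"
    using n(2) by (simp add: power_divide power2_eq_square)
  moreover have "sqrt (real n) / real n \<in> \<rat>" using q by simp
  ultimately have "sqrt (real n) / real n \<in> \<int>"
    using Rats_Ints_if_squarefree_mult_square[OF _ n(1), of "sqrt (real n) / real n"] by simp
  then obtain k where k: "sqrt (real n) / real n = of_int k" by (elim Ints_cases)
  have "(of_int k)\<^sup>2 * real n = 1" unfolding k[symmetric] by fact
  then have "of_int (k\<^sup>2 * int n) = (of_int 1 :: real)" by simp
  then have "k\<^sup>2 * int n = 1" by (simp only: of_int_eq_iff)
  then have "int n = 1" using n(2) by (auto simp: zmult_eq_1_iff)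
  then show False using n(2) by simp
qed

text \<open>The arguments \<open>u\<close> and \<open>v\<close> stand for square roots of 3 and s;
  keeping them variable makes conjugation a mere change of arguments.\<close>

definition quad :: "real \<Rightarrow> real \<Rightarrow> real \<Rightarrow> real \<Rightarrow> real \<Rightarrow> real \<Rightarrow> real" where
  "quad u v a b c d = a + b * u + c * v + d * (u * v)"

lemma quad_mult:
  assumes "u * u = 3" "v * v = s"
  shows "quad u v a b c d * quad u v a' b' c' d' =
    quad u v (a * a' + 3 * (b * b') + s * (c * c') + 3 * s * (d * d'))
      (a * b' + b * a' + s * (c * d' + d * c'))
      (a * c' + c * a' + 3 * (b * d' + d * b'))
      (a * d' + d * a' + b * c' + c * b')"
proof -
  have "quad u v a b c d * quad u v a' b' c' d' =
      a * a' + (b * b') * (u * u) + (c * c') * (v * v) + (d * d') * ((u * u) * (v * v))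
      + (a * b' + b * a') * u + (c * d' + d * c') * ((v * v) * u)
      + (a * c' + c * a') * v + (b * d' + d * b') * ((u * u) * v)
      + (a * d' + d * a' + b * c' + c * b') * (u * v)"
    by (simp add: quad_def algebra_simps)
  then show ?thesis
    unfolding assms by (simp add: quad_def algebra_simps)
qed

lemma square_mod_4: "\<exists>a. x * x = 4 * a + x mod 2" for x :: int
proof (cases "even x")
  case True
  then obtain y where "x = 2 * y" by (elim evenE)
  then have "x * x = 4 * (y * y) + x mod 2" by simp
  then show ?thesis by blast
next
  case False
  then obtain y where y: "x = 2 * y + 1" by (elim oddE)
  then have "x * x = 4 * (y * y + y) + x mod 2" by (simp add: algebra_simps)
  then show ?thesis by blast
qed

text \<open>The element is a root of X^2 - T X + N over \<int>[sqrt 3]. Multiplying this polynomial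
  by its conjugate gives a monic quartic with integer coefficients, the \<open>p\<close> of the
  proof.\<close>

lemma algebraic_int_lin_comb:
  assumes sq: "\<omega> * \<omega> = emb \<tau> * \<omega> + emb \<nu>"
  shows "algebraic_int (lin_comb \<omega> d b)"
proof -
  define x where "x = lin_comb \<omega> d b"
  define T where "T = 2 * d + b * \<tau>"
  define N where "N = d * d + d * b * \<tau> - \<nu> * (b * b)"
  have "emb 2 = 2" by (simp add: emb_def)
  then have "x * x - emb T * x + emb N = (emb b * emb b) * (\<omega> * \<omega> - emb \<tau> * \<omega> - emb \<nu>)"
    by (simp add: x_def lin_comb_def T_def N_def algebra_simps)
  then have eq: "x * x - emb T * x + emb N = 0" by (simp add: sq)
  define A where "A = x * x - rpart T * x + rpart N"
  define B where "B = spart T * x - spart N"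
  have "A = B * sqrt 3" using eq by (simp add: A_def B_def emb_def algebra_simps)
  then have AB: "A * A - 3 * (B * B) = 0" by (simp add: algebra_simps)
  define p :: "int poly" where "p = [:rpart N * rpart N - 3 * (spart N * spart N),
    6 * (spart T * spart N) - 2 * (rpart T * rpart N),
    rpart T * rpart T + 2 * rpart N - 3 * (spart T * spart T), - 2 * rpart T, 1:]"
  have "poly (map_poly of_int p) x = A * A - 3 * (B * B)"
    by (simp add: p_def A_def B_def map_poly_pCons algebra_simps)
  then show ?thesis
    unfolding x_def[symmetric] algebraic_int_altdef_ipoly using AB by (intro exI[of _ p]) (simp add: p_def)
qed

section \<open>The field Q(sqrt 3, sqrt s) in coordinates\<close>

locale biquadratic =
  fixes s :: nat
  assumes squarefree: "squarefree s" and not_3_dvd: "\<not> 3 dvd s" and s_gt_1: "1 < s"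
begin

lemma squarefree_3s: "squarefree (3 * s)"
  using squarefree not_3_dvd prime_imp_coprime[of 3 s]
  by (simp add: squarefree_mult_coprime squarefree_prime)

lemma sqrts [simp]:
  "sqrt 3 * sqrt 3 = 3" "sqrt (real s) * sqrt (real s) = real s"
  "sqrt 3 * (sqrt 3 * x) = 3 * x" "sqrt (real s) * (sqrt (real s) * x) = real s * x"
  by (simp_all add: mult.assoc[symmetric])

lemma irrational:
  "sqrt 3 \<notin> \<rat>" "sqrt (real s) \<notin> \<rat>" "sqrt 3 * sqrt (real s) \<notin> \<rat>"
  using sqrt_squarefree_irrational[of 3] sqrt_squarefree_irrational[OF squarefree s_gt_1]
    sqrt_squarefree_irrational[OF squarefree_3s] s_gt_1
  by (simp_all add: squarefree_prime real_sqrt_mult)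

lemma sqrt3_indep:
  assumes "a + b * sqrt 3 = 0" "a \<in> \<rat>" "b \<in> \<rat>"
  shows "a = 0 \<and> b = 0"
proof (cases "b = 0")
  case False
  then have "sqrt 3 = - a / b" using assms(1) by (simp add: field_simps)
  moreover have "- a / b \<in> \<rat>" using assms(2,3) by simp
  ultimately show ?thesis using irrational(1) by simp
qed (use assms in simp)

text \<open>A nontrivial relation with c + d sqrt 3 nonzero puts sqrt s into Q(sqrt 3), say sqrt s =
  f + g sqrt 3. Squaring gives f g = 0, so sqrt s or sqrt 3 sqrt s would be rational.\<close>

lemma quad_indep:
  assumes eq: "quad (sqrt 3) (sqrt s) a b c d = 0" and rat: "a \<in> \<rat>" "b \<in> \<rat>" "c \<in> \<rat>" "d \<in> \<rat>"
  shows "a = 0 \<and> b = 0 \<and> c = 0 \<and> d = 0"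
proof (cases "c + d * sqrt 3 = 0")
  case True
  have "a + b * sqrt 3 + (c + d * sqrt 3) * sqrt s = 0"
    using eq by (simp add: quad_def algebra_simps)
  then have "a + b * sqrt 3 = 0" using True by simp
  then show ?thesis using sqrt3_indep True rat by blast
next
  case False
  define w where "w = c * c - 3 * (d * d)"
  have w: "w = (c + d * sqrt 3) * (c - d * sqrt 3)" by (simp add: w_def algebra_simps)
  have "c - d * sqrt 3 \<noteq> 0"
    using sqrt3_indep[of c "- d"] False rat by auto
  then have w0: "w \<noteq> 0" using False w by simp
  define f where "f = - (a * c - 3 * (b * d)) / w"
  define g where "g = - (b * c - a * d) / w"
  have fg: "f \<in> \<rat>" "g \<in> \<rat>" using rat by (simp_all add: f_def g_def w_def)
  have "(c + d * sqrt 3) * sqrt s = - (a + b * sqrt 3)"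
    using eq by (simp add: quad_def algebra_simps)
  then have "w * sqrt s = - (a + b * sqrt 3) * (c - d * sqrt 3)"
    unfolding w by (simp add: mult_ac)
  also have "\<dots> = - (a * c - 3 * (b * d)) - (b * c - a * d) * sqrt 3"
    by (simp add: algebra_simps)
  finally have sqrt_s: "sqrt s = f + g * sqrt 3"
    using w0 by (simp add: f_def g_def field_simps)
  have "real s = (f + g * sqrt 3) * (f + g * sqrt 3)"
    unfolding sqrt_s[symmetric] by simp
  then have "(f * f + 3 * (g * g) - real s) + (2 * (f * g)) * sqrt 3 = 0"
    by (simp add: algebra_simps)
  then have "f * g = 0"
    using sqrt3_indep[of "f * f + 3 * (g * g) - real s" "2 * (f * g)"] fg by simp
  then have False
    using sqrt_s irrational(2,3) fg by (auto simp: mult_ac)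
  then show ?thesis ..
qed

definition K :: "real set" where
  "K = rat_adjoin {sqrt 3, sqrt (real s)}"

definition span :: "real set \<Rightarrow> real set" where
  "span R = {quad (sqrt 3) (sqrt s) a b c d | a b c d. a \<in> R \<and> b \<in> R \<and> c \<in> R \<and> d \<in> R}"

lemma spanI: "a \<in> R \<Longrightarrow> b \<in> R \<Longrightarrow> c \<in> R \<Longrightarrow> d \<in> R \<Longrightarrow> quad (sqrt 3) (sqrt s) a b c d \<in> span R"
  unfolding span_def by blast

lemma quad_add: "quad u v a b c d + quad u v a' b' c' d' = quad u v (a + a') (b + b') (c + c') (d + d')"
  by (simp add: quad_def algebra_simps)

lemma quad_scale: "m * quad u v a b c d = quad u v (m * a) (m * b) (m * c) (m * d)"
  by (simp add: quad_def algebra_simps)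

lemma span_Rats_closed:
  assumes "x \<in> span \<rat>" "y \<in> span \<rat>"
  shows "x + y \<in> span \<rat>" "x * y \<in> span \<rat>"
proof -
  obtain a b c d a' b' c' d' where
    "x = quad (sqrt 3) (sqrt s) a b c d" "a \<in> \<rat>" "b \<in> \<rat>" "c \<in> \<rat>" "d \<in> \<rat>"
    "y = quad (sqrt 3) (sqrt s) a' b' c' d'" "a' \<in> \<rat>" "b' \<in> \<rat>" "c' \<in> \<rat>" "d' \<in> \<rat>"
    using assms unfolding span_def by blast
  then show "x + y \<in> span \<rat>" "x * y \<in> span \<rat>"
    by (auto simp: quad_add quad_mult[of "sqrt 3" "sqrt s" s] intro!: spanI)
qed

lemma span_Ints_closed:
  assumes "x \<in> span \<int>" "y \<in> span \<int>"
  shows "x + y \<in> span \<int>" "x * y \<in> span \<int>"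
proof -
  obtain a b c d a' b' c' d' where
    "x = quad (sqrt 3) (sqrt s) a b c d" "a \<in> \<int>" "b \<in> \<int>" "c \<in> \<int>" "d \<in> \<int>"
    "y = quad (sqrt 3) (sqrt s) a' b' c' d'" "a' \<in> \<int>" "b' \<in> \<int>" "c' \<in> \<int>" "d' \<in> \<int>"
    using assms unfolding span_def by blast
  then show "x + y \<in> span \<int>" "x * y \<in> span \<int>"
    by (auto simp: quad_add quad_mult[of "sqrt 3" "sqrt s" s] intro!: spanI)
qed

lemma span_of_scalar: "a \<in> R \<Longrightarrow> 0 \<in> R \<Longrightarrow> a \<in> span R"
  using spanI[of a R 0 0 0] by (simp add: quad_def)

lemma span_Ints_sum: "(\<And>i. i \<in> A \<Longrightarrow> f i \<in> span \<int>) \<Longrightarrow> sum f A \<in> span \<int>"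
  by (induction A rule: infinite_finite_induct) (auto intro: span_Ints_closed span_of_scalar)

text \<open>Multiplication by the conjugate \<open>y\<close> under sqrt s -> - sqrt s leads into
  Q(sqrt 3); the factor \<open>z\<close> then inverts the relative norm there.\<close>

lemma span_Rats_inverse:
  assumes "x \<in> span \<rat>" "x \<noteq> 0"
  shows "inverse x \<in> span \<rat>"
proof -
  obtain a b c d where x: "x = quad (sqrt 3) (sqrt s) a b c d"
    and rat: "a \<in> \<rat>" "b \<in> \<rat>" "c \<in> \<rat>" "d \<in> \<rat>"
    using assms(1) unfolding span_def by blast
  define y where "y = quad (sqrt 3) (sqrt s) a b (- c) (- d)"
  have "y \<noteq> 0"
    using quad_indep[of a b "- c" "- d"] rat assms(2) by (auto simp: x y_def quad_def)
  define m where "m = a * a + 3 * (b * b) - s * (c * c) - 3 * s * (d * d)"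
  define n where "n = 2 * (a * b) - 2 * s * (c * d)"
  have xy: "x * y = m + n * sqrt 3"
    unfolding x y_def by (subst quad_mult[of _ _ s]) (simp_all add: quad_def m_def n_def algebra_simps)
  have mn: "m \<in> \<rat>" "n \<in> \<rat>" using rat by (simp_all add: m_def n_def)
  have "m + n * sqrt 3 \<noteq> 0" using xy assms(2) \<open>y \<noteq> 0\<close> by auto
  then have "m - n * sqrt 3 \<noteq> 0" using sqrt3_indep[of m "- n"] mn by auto
  define z where "z = (m - n * sqrt 3) / (m * m - 3 * (n * n))"
  have k: "m * m - 3 * (n * n) = (m + n * sqrt 3) * (m - n * sqrt 3)" by (simp add: algebra_simps)
  have "x * (y * z) = x * y * z" by (simp only: mult.assoc)
  also have "\<dots> = 1"
    unfolding z_def xy k using \<open>m + n * sqrt 3 \<noteq> 0\<close> \<open>m - n * sqrt 3 \<noteq> 0\<close> by simp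
  finally have "inverse x = y * z" by (rule inverse_unique)
  moreover have "y \<in> span \<rat>" unfolding y_def using rat by (intro spanI) auto
  moreover have "z \<in> span \<rat>"
  proof -
    have "z = quad (sqrt 3) (sqrt s) (m / (m * m - 3 * (n * n))) (- n / (m * m - 3 * (n * n))) 0 0"
      by (simp add: z_def quad_def diff_divide_distrib)
    then show ?thesis using mn by (auto intro!: spanI)
  qed
  ultimately show ?thesis using span_Rats_closed(2) by simp
qed

lemma K_subset_span: "K \<subseteq> span \<rat>"
proof
  interpret field "ring_of_type_algebra :: real ring" by (rule field_from_type_algebra)
  have ops: "x \<oplus>\<^bsub>ring_of_type_algebra\<^esub> y = x + y" "x \<otimes>\<^bsub>ring_of_type_algebra\<^esub> y = x * y"
    "\<zero>\<^bsub>ring_of_type_algebra\<^esub> = 0" "\<one>\<^bsub>ring_of_type_algebra\<^esub> = 1" "x \<in> carrier ring_of_type_algebra" for x y :: real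
    by (simp_all add: ring_of_type_algebra_def)
  have minus: "\<ominus>\<^bsub>ring_of_type_algebra\<^esub> x = - x" for x :: real
    by (rule minus_equality) (simp_all add: ops)
  have inv: "inv\<^bsub>ring_of_type_algebra\<^esub> x = inverse x" if "x \<noteq> 0" for x :: real
    by (rule comm_inv_char) (simp_all add: ops that)
  fix x assume "x \<in> K"
  then show "x \<in> span \<rat>"
    unfolding K_def rat_adjoin_def
  proof (induction rule: generate_field.induct)
    case (incl h)
    have "sqrt 3 \<in> span \<rat>" "sqrt s \<in> span \<rat>"
      using spanI[of 0 \<rat> 1 0 0] spanI[of 0 \<rat> 0 1 0] by (simp_all add: quad_def)
    then show ?case using incl by auto
  next
    case (a_inv h)
    have "- 1 * h \<in> span \<rat>"
      using span_Rats_closed(2)[of "- 1" h] span_of_scalar[of "- 1" \<rat>] a_inv by simp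
    then show ?case by (simp add: minus)
  next
    case (m_inv h)
    then show ?case using inv span_Rats_inverse by (simp add: ops)
  qed (auto simp: ops intro: span_of_scalar span_Rats_closed)
qed

text \<open>The quantifier order is the point: the coordinates of the power do not depend on the
  choice of the roots \<open>u\<close> and \<open>v\<close>, so information about one conjugate
  passes to all.\<close>

lemma quad_power:
  assumes "a \<in> \<rat>" "b \<in> \<rat>" "c \<in> \<rat>" "d \<in> \<rat>"
  shows "\<exists>A B C D. A \<in> \<rat> \<and> B \<in> \<rat> \<and> C \<in> \<rat> \<and> D \<in> \<rat> \<and>
    (\<forall>u v. u * u = 3 \<longrightarrow> v * v = real s \<longrightarrow> quad u v a b c d ^ k = quad u v A B C D)"
proof (induction k)
  case 0
  show ?case by (rule exI[of _ 1], rule exI[of _ 0], rule exI[of _ 0], rule exI[of _ 0]) (simp add: quad_def)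
next
  case (Suc k)
  then obtain A B C D where rat: "A \<in> \<rat>" "B \<in> \<rat>" "C \<in> \<rat>" "D \<in> \<rat>"
    and eq: "\<And>u v. u * u = 3 \<Longrightarrow> v * v = real s \<Longrightarrow> quad u v a b c d ^ k = quad u v A B C D"
    by blast
  have "quad u v a b c d ^ Suc k = quad u v (a * A + 3 * (b * B) + s * (c * C) + 3 * s * (d * D))
      (a * B + b * A + s * (c * D + d * C)) (a * C + c * A + 3 * (b * D + d * B)) (a * D + d * A + b * C + c * B)"
    if "u * u = 3" "v * v = real s" for u v
    using eq[OF that] quad_mult[OF that] by simp
  moreover have "a * A + 3 * (b * B) + s * (c * C) + 3 * s * (d * D) \<in> \<rat>" "a * B + b * A + s * (c * D + d * C) \<in> \<rat>"
    "a * C + c * A + 3 * (b * D + d * B) \<in> \<rat>" "a * D + d * A + b * C + c * B \<in> \<rat>"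
    using assms rat by auto
  ultimately show ?case by blast
qed

section \<open>Integrality through bounded denominators\<close>

lemma span_Rats_power: "x \<in> span \<rat> \<Longrightarrow> x ^ k \<in> span \<rat>"
  by (induction k) (auto intro: span_of_scalar span_Rats_closed)

lemma span_Rats_denominator:
  assumes "x \<in> span \<rat>"
  shows "\<exists>M::int. 0 < M \<and> of_int M * x \<in> span \<int>"
proof -
  obtain a b c d where x: "x = quad (sqrt 3) (sqrt s) a b c d"
    and rat: "a \<in> \<rat>" "b \<in> \<rat>" "c \<in> \<rat>" "d \<in> \<rat>"
    using assms unfolding span_def by blast
  have den: "\<exists>m::int. 0 < m \<and> of_int m * y \<in> \<int>" if "y \<in> \<rat>" for y :: real
    using that by (elim Rats_cases') (metis Ints_of_int nonzero_mult_div_cancel_left of_int_0_eq_iff order_less_irrefl times_divide_eq_right)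
  obtain m1 m2 m3 m4 :: int where m: "0 < m1" "of_int m1 * a \<in> \<int>" "0 < m2" "of_int m2 * b \<in> \<int>"
    "0 < m3" "of_int m3 * c \<in> \<int>" "0 < m4" "of_int m4 * d \<in> \<int>"
    using den[OF rat(1)] den[OF rat(2)] den[OF rat(3)] den[OF rat(4)] by metis
  define M where "M = m1 * m2 * (m3 * m4)"
  have "of_int M * a = of_int (m2 * (m3 * m4)) * (of_int m1 * a)" "of_int M * b = of_int (m1 * (m3 * m4)) * (of_int m2 * b)"
    "of_int M * c = of_int (m1 * m2 * m4) * (of_int m3 * c)" "of_int M * d = of_int (m1 * m2 * m3) * (of_int m4 * d)"
    by (simp_all add: M_def mult_ac)
  then have "of_int M * a \<in> \<int>" "of_int M * b \<in> \<int>" "of_int M * c \<in> \<int>" "of_int M * d \<in> \<int>"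
    using m by (simp_all only: Ints_mult Ints_of_int)
  then have "of_int M * x \<in> span \<int>" unfolding x quad_scale by (intro spanI)
  moreover have "0 < M" using m by (simp add: M_def)
  ultimately show ?thesis by blast
qed

text \<open>A substitute for integrality that is easily seen to be closed under sums and products.\<close>

definition almost_integral :: "real \<Rightarrow> bool" where
  "almost_integral x \<longleftrightarrow> (\<exists>M::int. 0 < M \<and> (\<forall>k. of_int M * x ^ k \<in> span \<int>))"

lemma almost_integral_of_span: "x \<in> span \<int> \<Longrightarrow> almost_integral x"
proof -
  assume x: "x \<in> span \<int>"
  have "x ^ k \<in> span \<int>" for k
    by (induction k) (auto intro: span_of_scalar span_Ints_closed x)
  then show ?thesis unfolding almost_integral_def by (intro exI[of _ 1]) simp
qed

lemma almost_integral_mult: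
  assumes "almost_integral x" "almost_integral y"
  shows "almost_integral (x * y)"
proof -
  obtain M N :: int where M: "0 < M" "\<And>k. of_int M * x ^ k \<in> span \<int>"
    and N: "0 < N" "\<And>k. of_int N * y ^ k \<in> span \<int>"
    using assms unfolding almost_integral_def by blast
  have "of_int (M * N) * (x * y) ^ k \<in> span \<int>" for k
  proof -
    have "of_int (M * N) * (x * y) ^ k = (of_int M * x ^ k) * (of_int N * y ^ k)"
      by (simp add: power_mult_distrib)
    also have "\<dots> \<in> span \<int>" by (intro span_Ints_closed(2) M N)
    finally show ?thesis .
  qed
  then show ?thesis unfolding almost_integral_def using M N by (intro exI[of _ "M * N"]) simp
qed

lemma almost_integral_add:
  assumes "almost_integral x" "almost_integral y"
  shows "almost_integral (x + y)"
proof -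
  obtain M N :: int where M: "0 < M" "\<And>k. of_int M * x ^ k \<in> span \<int>"
    and N: "0 < N" "\<And>k. of_int N * y ^ k \<in> span \<int>"
    using assms unfolding almost_integral_def by blast
  have "of_int (M * N) * (x + y) ^ k \<in> span \<int>" for k
  proof -
    have "of_int (M * N) * (x + y) ^ k =
        (\<Sum>i\<le>k. of_nat (k choose i) * ((of_int M * x ^ i) * (of_int N * y ^ (k - i))))"
      unfolding binomial_ring sum_distrib_left by (intro sum.cong refl) (simp add: mult_ac)
    also have "\<dots> \<in> span \<int>"
      by (intro span_Ints_sum span_Ints_closed(2) M N span_of_scalar) auto
    finally show ?thesis .
  qed
  then show ?thesis unfolding almost_integral_def using M N by (intro exI[of _ "M * N"]) simp
qed

lemma almost_integral_diff:
  assumes "almost_integral x" "almost_integral y"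
  shows "almost_integral (x - y)"
proof -
  have "almost_integral (- 1)" by (intro almost_integral_of_span span_of_scalar) auto
  then have "almost_integral (x + - 1 * y)" by (intro almost_integral_add almost_integral_mult assms)
  then show ?thesis by simp
qed

lemma span_Ints_quadD:
  assumes "quad (sqrt 3) (sqrt s) a b c d \<in> span \<int>" "a \<in> \<rat>" "b \<in> \<rat>" "c \<in> \<rat>" "d \<in> \<rat>"
  shows "a \<in> \<int> \<and> b \<in> \<int> \<and> c \<in> \<int> \<and> d \<in> \<int>"
proof -
  obtain a' b' c' d' where eq: "quad (sqrt 3) (sqrt s) a b c d = quad (sqrt 3) (sqrt s) a' b' c' d'"
    and int: "a' \<in> \<int>" "b' \<in> \<int>" "c' \<in> \<int>" "d' \<in> \<int>"
    using assms(1) unfolding span_def by blast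
  have "quad (sqrt 3) (sqrt s) (a - a') (b - b') (c - c') (d - d') = 0"
    using eq by (simp add: quad_def algebra_simps)
  moreover have "a' \<in> \<rat>" "b' \<in> \<rat>" "c' \<in> \<rat>" "d' \<in> \<rat>" using int Ints_subset_Rats by auto
  ultimately have "a = a'" "b = b'" "c = c'" "d = d'"
    using quad_indep[of "a - a'" "b - b'" "c - c'" "d - d'"] assms(2-5) by auto
  then show ?thesis using int by simp
qed

text \<open>By \<open>quad_power\<close> conjugation changes only signs of the coordinates of each
  power, so the same denominator \<open>M\<close> works.\<close>

lemma almost_integral_conj:
  assumes ai: "almost_integral (quad (sqrt 3) (sqrt s) a b c d)"
    and rat: "a \<in> \<rat>" "b \<in> \<rat>" "c \<in> \<rat>" "d \<in> \<rat>" and sgn: "e \<in> {1, - 1}" "f \<in> {1, - 1}"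
  shows "almost_integral (quad (e * sqrt 3) (f * sqrt s) a b c d)"
proof -
  obtain M :: int where M: "0 < M" "\<And>k. of_int M * quad (sqrt 3) (sqrt s) a b c d ^ k \<in> span \<int>"
    using ai unfolding almost_integral_def by blast
  have "of_int M * quad (e * sqrt 3) (f * sqrt s) a b c d ^ k \<in> span \<int>" for k
  proof -
    obtain A B C D where r: "A \<in> \<rat>" "B \<in> \<rat>" "C \<in> \<rat>" "D \<in> \<rat>"
      and eq: "\<And>u v. u * u = 3 \<Longrightarrow> v * v = real s \<Longrightarrow> quad u v a b c d ^ k = quad u v A B C D"
      using quad_power[OF rat, of k] by blast
    have "of_int M * A \<in> \<int> \<and> of_int M * B \<in> \<int> \<and> of_int M * C \<in> \<int> \<and> of_int M * D \<in> \<int>"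
      using M(2)[of k] r by (intro span_Ints_quadD) (simp_all add: eq quad_scale[symmetric])
    then have int: "of_int M * A \<in> \<int>" "e * (of_int M * B) \<in> \<int>" "f * (of_int M * C) \<in> \<int>" "e * f * (of_int M * D) \<in> \<int>"
      using sgn by auto
    have sq: "e * sqrt 3 * (e * sqrt 3) = 3" "f * sqrt s * (f * sqrt s) = real s"
      using sgn by auto
    have "of_int M * quad (e * sqrt 3) (f * sqrt s) a b c d ^ k = quad (sqrt 3) (sqrt s) (of_int M * A)
        (e * (of_int M * B)) (f * (of_int M * C)) (e * f * (of_int M * D))"
      unfolding eq[OF sq] by (simp add: quad_def algebra_simps)
    then show ?thesis using int by (simp add: spanI)
  qed
  then show ?thesis unfolding almost_integral_def using M(1) by blast
qed

text \<open>If b is the denominator of \<open>x\<close>, then b^k divides \<open>M\<close> for every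
  k. Taking k = M contradicts M < 2^M unless b = 1.\<close>

lemma almost_integral_rat:
  assumes ai: "almost_integral x" and x: "x \<in> \<rat>"
  shows "x \<in> \<int>"
proof -
  obtain M :: int where M: "0 < M" "\<And>k. of_int M * x ^ k \<in> span \<int>"
    using ai unfolding almost_integral_def by blast
  obtain a b :: int where ab: "0 < b" "coprime a b" "x = of_int a / of_int b"
    using x by (rule Rats_cases')
  define k where "k = nat M"
  have "quad (sqrt 3) (sqrt s) (of_int M * x ^ k) 0 0 0 \<in> span \<int>"
    using M(2)[of k] by (simp add: quad_def)
  then have "of_int M * x ^ k \<in> \<int>" using span_Ints_quadD x by simp
  then obtain m where "of_int M * x ^ k = of_int m" by (elim Ints_cases)
  then have "of_int M * of_int a ^ k = (of_int m * of_int b ^ k :: real)"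
    using ab(1) by (simp add: ab(3) power_divide field_simps)
  then have "of_int (M * a ^ k) = (of_int (m * b ^ k) :: real)" by simp
  then have "M * a ^ k = m * b ^ k" by (simp only: of_int_eq_iff)
  then have "b ^ k dvd M * a ^ k" by simp
  moreover have "coprime (b ^ k) (a ^ k)" using ab(2) by (simp add: coprime_commute)
  ultimately have "b ^ k dvd M" by (simp add: coprime_dvd_mult_left_iff)
  then have le: "b ^ k \<le> M" using M(1) by (rule zdvd_imp_le)
  have "b = 1"
  proof (rule ccontr)
    assume "b \<noteq> 1"
    then have "2 ^ k \<le> b ^ k" using ab(1) by (intro power_mono) auto
    moreover have "int k < 2 ^ k" using of_nat_less_two_power[of k] by simp
    ultimately show False using le M(1) by (simp add: k_def)
  qed
  then show ?thesis using ab(3) by simp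
qed

text \<open>A common denominator of the powers below the degree serves for all powers, since the
  monic equation reduces higher powers with integer coefficients.\<close>

lemma almost_integral_of_algebraic_int:
  assumes x: "x \<in> span \<rat>" and int: "algebraic_int x"
  shows "almost_integral x"
proof -
  obtain p :: "int poly" where p: "poly (map_poly of_int p) x = 0" "lead_coeff p = 1"
    using int unfolding algebraic_int_altdef_ipoly by blast
  define n where "n = degree p"
  have "\<exists>M::int. 0 < M \<and> of_int M * x ^ k \<in> span \<int>" for k
    using span_Rats_denominator span_Rats_power[OF x] by blast
  then obtain m :: "nat \<Rightarrow> int" where m: "\<And>k. 0 < m k" "\<And>k. of_int (m k) * x ^ k \<in> span \<int>" by metis
  define M where "M = (\<Prod>k<n. m k)"
  have small: "of_int M * x ^ k \<in> span \<int>" if "k < n" for k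
  proof -
    have "M = (\<Prod>j\<in>{..<n} - {k}. m j) * m k"
      unfolding M_def using that by (subst prod.remove[of _ k]) auto
    then have "of_int M * x ^ k = of_int (\<Prod>j\<in>{..<n} - {k}. m j) * (of_int (m k) * x ^ k)"
      by (simp add: mult_ac)
    also have "\<dots> \<in> span \<int>" by (intro span_Ints_closed(2) span_of_scalar m) auto
    finally show ?thesis .
  qed
  have "0 = (\<Sum>i\<le>n. of_int (coeff p i) * x ^ i)"
    using p(1) by (simp add: poly_altdef n_def coeff_map_poly degree_map_poly)
  also have "\<dots> = (\<Sum>i<n. of_int (coeff p i) * x ^ i) + x ^ n"
    using p(2) by (simp add: lessThan_Suc_atMost[symmetric] n_def)
  finally have xn: "x ^ n = - (\<Sum>i<n. of_int (coeff p i) * x ^ i)" by simp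
  have "of_int M * x ^ k \<in> span \<int>" for k
  proof (induction k rule: less_induct)
    case (less k)
    show ?case
    proof (cases "k < n")
      case False
      then have "x ^ k = x ^ (k - n) * x ^ n" by (simp add: power_add[symmetric])
      then have "of_int M * x ^ k = (\<Sum>i<n. of_int (- coeff p i) * (of_int M * x ^ (k - n + i)))"
        by (simp add: xn sum_distrib_left sum_negf power_add mult_ac)
      also have "\<dots> \<in> span \<int>"
      proof (rule span_Ints_sum)
        fix i assume "i \<in> {..<n}"
        then have IH: "of_int M * x ^ (k - n + i) \<in> span \<int>" using False by (intro less.IH) auto
        have "of_int (- coeff p i) \<in> span \<int>" by (intro span_of_scalar Ints_of_int Ints_0)
        then show "of_int (- coeff p i) * (of_int M * x ^ (k - n + i)) \<in> span \<int>"
          using IH by (rule span_Ints_closed(2))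
      qed
      finally show ?thesis .
    qed (rule small)
  qed
  moreover have "0 < M" unfolding M_def using m(1) by (simp add: prod_pos)
  ultimately show ?thesis unfolding almost_integral_def by blast
qed

text \<open>\<int>[sqrt 3] is integrally closed. Trace and norm leave only a denominator 2, and a^2
  - 3 b^2, which is a^2 + b^2 modulo 4, is divisible by 4 only for even a and b.\<close>

lemma almost_integral_sqrt3:
  assumes ai: "almost_integral (m + n * sqrt 3)" and rat: "m \<in> \<rat>" "n \<in> \<rat>"
  shows "m \<in> \<int> \<and> n \<in> \<int>"
proof -
  have ai': "almost_integral (m - n * sqrt 3)"
    using almost_integral_conj[of m n 0 0 "- 1" 1] ai rat by (simp add: quad_def)
  have "almost_integral (2 * m)"
    using almost_integral_add[OF ai ai'] by simp
  then have "2 * m \<in> \<int>" using rat by (intro almost_integral_rat) auto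
  then obtain a :: int where a: "2 * m = of_int a" by (elim Ints_cases)
  have "almost_integral ((2 * n)\<^sup>2 * real 3)"
    using almost_integral_mult[OF almost_integral_diff[OF ai ai'] almost_integral_diff[OF ai ai']]
    by (simp add: algebra_simps power2_eq_square)
  then have int: "(2 * n)\<^sup>2 * real 3 \<in> \<int>" by (rule almost_integral_rat) (use rat in simp)
  have sf: "squarefree (3::nat)" by (simp add: squarefree_prime)
  have "2 * n \<in> \<int>"
    by (rule Rats_Ints_if_squarefree_mult_square[OF _ sf int]) (use rat in simp)
  then obtain b :: int where b: "2 * n = of_int b" by (elim Ints_cases)
  have "almost_integral (m * m - 3 * (n * n))"
    using almost_integral_mult[OF ai ai'] by (simp add: algebra_simps)
  then have "m * m - 3 * (n * n) \<in> \<int>" using rat by (intro almost_integral_rat) auto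
  then obtain w :: int where w: "m * m - 3 * (n * n) = of_int w" by (elim Ints_cases)
  have "(2 * m) * (2 * m) - 3 * ((2 * n) * (2 * n)) = 4 * of_int w"
    unfolding w[symmetric] by (simp add: algebra_simps)
  then have "of_int (a * a - 3 * (b * b)) = (of_int (4 * w) :: real)"
    unfolding a b by simp
  then have eq: "a * a - 3 * (b * b) = 4 * w" by (simp only: of_int_eq_iff)
  obtain a' b' where "a * a = 4 * a' + a mod 2" "b * b = 4 * b' + b mod 2"
    using square_mod_4[of a] square_mod_4[of b] by blast
  then have "4 * a' + a mod 2 - 3 * (4 * b' + b mod 2) = 4 * w" using eq by simp
  then have "even a \<and> even b" by presburger
  then obtain a'' b'' where "a = 2 * a''" "b = 2 * b''" by (auto elim!: evenE)
  then have "m = of_int a''" "n = of_int b''" using a b by simp_all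
  then show ?thesis by simp
qed

text \<open>The trace and the norm of \<open>x\<close> relative to Q(sqrt 3) lie in \<int>[sqrt 3]:
  the trace makes 2a and 2b integral, the norm gives the two congruences. Alternating sums of the
  four conjugates isolate 4c sqrt s and 4d sqrt 3 sqrt s, whose squares are integers.\<close>

lemma integral_coefficients:
  assumes x: "x \<in> span \<rat>" and ai: "almost_integral x"
  obtains P Q R T u v :: int where
    "4 * x = quad (sqrt 3) (sqrt s) (2 * of_int P) (2 * of_int Q) (of_int R) (of_int T)"
    "4 * (P * P + 3 * (Q * Q)) - int s * (R * R + 3 * (T * T)) = 16 * u"
    "4 * (P * Q) - int s * (R * T) = 8 * v"
proof -
  obtain a b c d where x_eq: "x = quad (sqrt 3) (sqrt s) a b c d"
    and rat: "a \<in> \<rat>" "b \<in> \<rat>" "c \<in> \<rat>" "d \<in> \<rat>"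
    using x unfolding span_def by blast
  define y where "y = quad (sqrt 3) (- sqrt s) a b c d"
  define z where "z = quad (- sqrt 3) (sqrt s) a b c d"
  define w where "w = quad (- sqrt 3) (- sqrt s) a b c d"
  have ai': "almost_integral y" "almost_integral z" "almost_integral w"
    using almost_integral_conj[OF ai[unfolded x_eq] rat, of 1 "- 1"]
      almost_integral_conj[OF ai[unfolded x_eq] rat, of "- 1" 1]
      almost_integral_conj[OF ai[unfolded x_eq] rat, of "- 1" "- 1"]
    by (simp_all add: y_def z_def w_def)
  have "x + y = 2 * a + (2 * b) * sqrt 3" by (simp add: x_eq y_def quad_def)
  then have "almost_integral (2 * a + (2 * b) * sqrt 3)" using almost_integral_add[OF ai ai'(1)] by simp
  then have "2 * a \<in> \<int> \<and> 2 * b \<in> \<int>" using rat by (intro almost_integral_sqrt3) auto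
  then obtain P Q :: int where PQ: "2 * a = of_int P" "2 * b = of_int Q" by (metis Ints_cases)
  have "(x + z) - (y + w) = 4 * c * sqrt s" by (simp add: x_eq y_def z_def w_def quad_def)
  then have ac: "almost_integral (4 * c * sqrt s)"
    using almost_integral_diff[OF almost_integral_add[OF ai ai'(2)] almost_integral_add[OF ai'(1,3)]] by simp
  have "almost_integral ((4 * c)\<^sup>2 * real s)"
    using almost_integral_mult[OF ac ac] by (simp add: power2_eq_square mult_ac)
  then have int: "(4 * c)\<^sup>2 * real s \<in> \<int>" by (rule almost_integral_rat) (use rat in simp)
  have "4 * c \<in> \<int>"
    by (rule Rats_Ints_if_squarefree_mult_square[OF _ squarefree int]) (use rat in simp)
  then obtain R :: int where R: "4 * c = of_int R" by (elim Ints_cases)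
  have "(x + w) - (y + z) = 4 * d * (sqrt 3 * sqrt s)" by (simp add: x_eq y_def z_def w_def quad_def)
  then have ad: "almost_integral (4 * d * (sqrt 3 * sqrt s))"
    using almost_integral_diff[OF almost_integral_add[OF ai ai'(3)] almost_integral_add[OF ai'(1,2)]] by simp
  have "almost_integral ((4 * d)\<^sup>2 * real (3 * s))"
    using almost_integral_mult[OF ad ad] by (simp add: power2_eq_square mult_ac)
  then have int: "(4 * d)\<^sup>2 * real (3 * s) \<in> \<int>" by (rule almost_integral_rat) (use rat in simp)
  have "4 * d \<in> \<int>"
    by (rule Rats_Ints_if_squarefree_mult_square[OF _ squarefree_3s int]) (use rat in simp)
  then obtain T :: int where T: "4 * d = of_int T" by (elim Ints_cases)
  define m where "m = a * a + 3 * (b * b) - s * (c * c + 3 * (d * d))"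
  define n where "n = 2 * (a * b) - 2 * (s * (c * d))"
  have "x * y = m + n * sqrt 3"
    by (simp add: x_eq y_def quad_def m_def n_def algebra_simps)
  then have "almost_integral (m + n * sqrt 3)" using almost_integral_mult[OF ai ai'(1)] by simp
  then have "m \<in> \<int> \<and> n \<in> \<int>" using rat by (intro almost_integral_sqrt3) (auto simp: m_def n_def)
  then obtain u v :: int where uv: "m = of_int u" "n = of_int v" by (metis Ints_cases)
  have "4 * ((2 * a) * (2 * a) + 3 * ((2 * b) * (2 * b))) - s * ((4 * c) * (4 * c) + 3 * ((4 * d) * (4 * d))) = 16 * m"
    by (simp add: m_def algebra_simps)
  then have "of_int (4 * (P * P + 3 * (Q * Q)) - int s * (R * R + 3 * (T * T))) = (of_int (16 * u) :: real)"
    unfolding PQ R T uv by simp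
  then have 1: "4 * (P * P + 3 * (Q * Q)) - int s * (R * R + 3 * (T * T)) = 16 * u"
    by (simp only: of_int_eq_iff)
  have "4 * ((2 * a) * (2 * b)) - s * ((4 * c) * (4 * d)) = 8 * n"
    by (simp add: n_def algebra_simps)
  then have "of_int (4 * (P * Q) - int s * (R * T)) = (of_int (8 * v) :: real)"
    unfolding PQ R T uv by simp
  then have 2: "4 * (P * Q) - int s * (R * T) = 8 * v"
    by (simp only: of_int_eq_iff)
  have "4 * x = quad (sqrt 3) (sqrt s) (2 * of_int P) (2 * of_int Q) (of_int R) (of_int T)"
    unfolding x_eq PQ[symmetric] R[symmetric] T[symmetric] by (simp add: quad_def algebra_simps)
  then show ?thesis using 1 2 by (rule that)
qed

lemma K_closed:
  "sqrt 3 \<in> K" "sqrt s \<in> K" "x \<in> K \<Longrightarrow> y \<in> K \<Longrightarrow> x + y \<in> K" "x \<in> K \<Longrightarrow> y \<in> K \<Longrightarrow> x * y \<in> K"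
  "x \<in> K \<Longrightarrow> x / 2 \<in> K" "of_int k \<in> K"
proof -
  interpret field "ring_of_type_algebra :: real ring" by (rule field_from_type_algebra)
  have ops: "x \<oplus>\<^bsub>ring_of_type_algebra\<^esub> y = x + y" "x \<otimes>\<^bsub>ring_of_type_algebra\<^esub> y = x * y"
    "\<zero>\<^bsub>ring_of_type_algebra\<^esub> = 0" "\<one>\<^bsub>ring_of_type_algebra\<^esub> = 1" "x \<in> carrier ring_of_type_algebra" for x y :: real
    by (simp_all add: ring_of_type_algebra_def)
  have minus: "\<ominus>\<^bsub>ring_of_type_algebra\<^esub> x = - x" for x :: real
    by (rule minus_equality) (simp_all add: ops)
  have inv: "inv\<^bsub>ring_of_type_algebra\<^esub> x = inverse x" if "x \<noteq> 0" for x :: real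
    by (rule comm_inv_char) (simp_all add: ops that)
  show "sqrt 3 \<in> K" "sqrt s \<in> K"
    unfolding K_def rat_adjoin_def by (auto intro: generate_field.incl)
  have one: "1 \<in> K" using generate_field.one[of ring_of_type_algebra] by (simp add: K_def rat_adjoin_def ops)
  show add: "x + y \<in> K" if "x \<in> K" "y \<in> K" for x y
    using generate_field.eng_add[of x ring_of_type_algebra _ y] that by (simp add: K_def rat_adjoin_def ops)
  show mult: "x * y \<in> K" if "x \<in> K" "y \<in> K" for x y
    using generate_field.eng_mult[of x ring_of_type_algebra _ y] that by (simp add: K_def rat_adjoin_def ops)
  have neg: "- x \<in> K" if "x \<in> K" for x
    using generate_field.a_inv[of x ring_of_type_algebra] that by (simp add: K_def rat_adjoin_def minus)
  have zero: "0 \<in> K" using add[OF one neg[OF one]] by simp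
  have half: "inverse 2 \<in> K"
    using generate_field.m_inv[of "2 :: real" ring_of_type_algebra] add[OF one one] by (simp add: K_def rat_adjoin_def ops inv)
  show "x / 2 \<in> K" if "x \<in> K" for x
    unfolding divide_inverse using that half by (rule mult)
  have nat: "real n \<in> K" for n
  proof (induction n)
    case (Suc n)
    show ?case unfolding of_nat_Suc by (rule add[OF one Suc])
  qed (simp add: zero)
  show "of_int k \<in> K"
    using nat[of "nat k"] neg[OF nat[of "nat (- k)"]] by (cases "0 \<le> k") simp_all
qed

lemma emb_mem_K: "emb z \<in> K"
  unfolding emb_def by (intro K_closed)

lemma mem_ring_of_integers: "x \<in> carrier (ring_of_integers K) \<longleftrightarrow> x \<in> K \<and> algebraic_int x"
  by (simp add: ring_of_integers_def)

lemma emb_sqrt_indep: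
  assumes "emb x + emb y * sqrt s = 0"
  shows "x = 0 \<and> y = 0"
proof -
  have "quad (sqrt 3) (sqrt s) (of_int (rpart x)) (of_int (spart x)) (of_int (rpart y)) (of_int (spart y)) = 0"
    using assms by (simp add: quad_def emb_def algebra_simps)
  then have "real_of_int (rpart x) = 0 \<and> real_of_int (spart x) = 0 \<and>
      real_of_int (rpart y) = 0 \<and> real_of_int (spart y) = 0"
    by (rule quad_indep) (simp_all add: Ints_subset_Rats[THEN subsetD])
  then show ?thesis by (simp add: zsqrt3_eq_iff)
qed

end

section \<open>Lower bounds for definite forms at nonzero integer points\<close>

lemma quadratic_form_gt:
  fixes a k m x :: int
  assumes "2 * \<bar>k\<bar> + m < a" "0 \<le> m"
  shows "0 \<le> a * (x * x) - 2 * (k * x)" "x \<noteq> 0 \<Longrightarrow> m < a * (x * x) - 2 * (k * x)"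
proof -
  have "\<bar>x\<bar> \<le> x * x"
    using mult_left_mono[of 1 "\<bar>x\<bar>" "\<bar>x\<bar>"] by (cases "x = 0") simp_all
  then have "a * \<bar>x\<bar> \<le> a * (x * x)" using assms by (intro mult_left_mono) simp_all
  moreover have "k * x \<le> \<bar>k\<bar> * \<bar>x\<bar>" by (metis abs_ge_self abs_mult)
  ultimately have ge: "(a - 2 * \<bar>k\<bar>) * \<bar>x\<bar> \<le> a * (x * x) - 2 * (k * x)"
    by (simp add: algebra_simps)
  have "0 \<le> (a - 2 * \<bar>k\<bar>) * \<bar>x\<bar>" using assms by simp
  then show "0 \<le> a * (x * x) - 2 * (k * x)" using ge by linarith
  assume "x \<noteq> 0"
  have "m < (a - 2 * \<bar>k\<bar>) * 1" using assms by simp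
  also have "\<dots> \<le> (a - 2 * \<bar>k\<bar>) * \<bar>x\<bar>" using assms \<open>x \<noteq> 0\<close> by (intro mult_left_mono) simp_all
  finally show "m < a * (x * x) - 2 * (k * x)" using ge by (rule less_le_trans)
qed

lemma hexagonal_form_gt:
  fixes a k l m p q :: int
  assumes "2 * \<bar>k\<bar> + m < a" "2 * \<bar>l\<bar> + m < a" "0 \<le> m" "0 \<le> p * q" "p \<noteq> 0 \<or> q \<noteq> 0"
  shows "m < a * (p * p + p * q + q * q) - 2 * (k * p + l * q)"
proof -
  have "0 \<le> a * (p * q)" using assms by simp
  moreover have "m < (a * (p * p) - 2 * (k * p)) + (a * (q * q) - 2 * (l * q))"
    using quadratic_form_gt[OF assms(1,3), of p] quadratic_form_gt[OF assms(2,3), of q] assms(5) by linarith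
  ultimately show ?thesis by (simp add: algebra_simps)
qed

section \<open>Integral bases over \<int>[sqrt 3]\<close>

context biquadratic
begin

lemma integral_coefficients_odd:
  assumes x: "x \<in> carrier (ring_of_integers K)" and odd: "odd s"
  obtains P Q r t u v :: int where
    "2 * x = quad (sqrt 3) (sqrt s) (of_int P) (of_int Q) (of_int r) (of_int t)"
    "P * P + 3 * (Q * Q) - int s * (r * r + 3 * (t * t)) = 4 * u"
    "P * Q - int s * (r * t) = 2 * v"
proof -
  have "x \<in> span \<rat>" using x K_subset_span by (auto simp: mem_ring_of_integers)
  then have "almost_integral x" using x almost_integral_of_algebraic_int by (simp add: mem_ring_of_integers)
  then obtain P Q R T u v :: int where
    eq: "4 * x = quad (sqrt 3) (sqrt s) (2 * of_int P) (2 * of_int Q) (of_int R) (of_int T)"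
    and u: "4 * (P * P + 3 * (Q * Q)) - int s * (R * R + 3 * (T * T)) = 16 * u"
    and v: "4 * (P * Q) - int s * (R * T) = 8 * v"
    using integral_coefficients[OF \<open>x \<in> span \<rat>\<close>] by metis
  have gen: "even z" if "4 * c - z = 8 * w" for c z w :: int using that by presburger
  have "4 * (P * P + 3 * (Q * Q)) - int s * (R * R + 3 * (T * T)) = 8 * (2 * u)" using u by linarith
  then have "even (int s * (R * R + 3 * (T * T)))" by (rule gen)
  moreover have "even (int s * (R * T))" using v by (rule gen)
  ultimately have "even R \<and> even T" using odd by auto
  then obtain r t where rt: "R = 2 * r" "T = 2 * t" by (auto elim!: evenE)
  have "2 * x = quad (sqrt 3) (sqrt s) (of_int P) (of_int Q) (of_int r) (of_int t)"
    using eq unfolding rt by (simp add: quad_def algebra_simps)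
  moreover have "P * P + 3 * (Q * Q) - int s * (r * r + 3 * (t * t)) = 4 * u"
    using u unfolding rt by (simp add: algebra_simps)
  moreover have "P * Q - int s * (r * t) = 2 * v"
    using v unfolding rt by (simp add: algebra_simps)
  ultimately show ?thesis by (rule that)
qed

text \<open>With s = 2c and c odd the two norm congruences are halved repeatedly: first
  \<open>R\<close> and \<open>T\<close> are even, then \<open>P\<close> and \<open>Q\<close>, and
  what remains is the parity of \<open>r - t\<close>.\<close>

lemma integral_coefficients_even:
  assumes x: "x \<in> carrier (ring_of_integers K)" and s: "s mod 4 = 2"
  obtains P Q r t :: int where
    "2 * x = quad (sqrt 3) (sqrt s) (2 * of_int P) (2 * of_int Q) (of_int r) (of_int t)" "even (r - t)"
proof -
  have "x \<in> span \<rat>" using x K_subset_span by (auto simp: mem_ring_of_integers)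
  then have "almost_integral x" using x almost_integral_of_algebraic_int by (simp add: mem_ring_of_integers)
  then obtain P Q R T u v :: int where
    eq: "4 * x = quad (sqrt 3) (sqrt s) (2 * of_int P) (2 * of_int Q) (of_int R) (of_int T)"
    and u: "4 * (P * P + 3 * (Q * Q)) - int s * (R * R + 3 * (T * T)) = 16 * u"
    and v: "4 * (P * Q) - int s * (R * T) = 8 * v"
    using integral_coefficients[OF \<open>x \<in> span \<rat>\<close>] by metis
  define c where "c = int (s div 2)"
  have c: "int s = 2 * c" "odd c" using s unfolding c_def by presburger+
  have u': "2 * (P * P + 3 * (Q * Q)) - c * (R * R + 3 * (T * T)) = 8 * u"
    and v': "2 * (P * Q) - c * (R * T) = 4 * v"
    using u v unfolding c(1) by simp_all
  have gen: "even z" if "2 * a - z = 4 * w" for a z w :: int using that by presburger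
  have "2 * (P * P + 3 * (Q * Q)) - c * (R * R + 3 * (T * T)) = 4 * (2 * u)" using u' by linarith
  then have "even (c * (R * R + 3 * (T * T)))" by (rule gen)
  moreover have "even (c * (R * T))" using v' by (rule gen)
  ultimately have "even R \<and> even T" using c(2) by auto
  then obtain r t where rt: "R = 2 * r" "T = 2 * t" by (auto elim!: evenE)
  have u'': "(P * P + 3 * (Q * Q)) - 2 * (c * (r * r + 3 * (t * t))) = 4 * u"
    using u' unfolding rt by (simp add: algebra_simps)
  have v'': "P * Q - 2 * (c * (r * t)) = 2 * v"
    using v' unfolding rt by (simp add: algebra_simps)
  have gen': "even z" if "z - 2 * a = 2 * w" for a z w :: int using that by presburger
  have "(P * P + 3 * (Q * Q)) - 2 * (c * (r * r + 3 * (t * t))) = 2 * (2 * u)" using u'' by linarith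
  then have "even (P * P + 3 * (Q * Q))" by (rule gen')
  moreover have "even (P * Q)" using v'' by (rule gen')
  ultimately have "even P \<and> even Q" by auto
  then obtain p q where pq: "P = 2 * p" "Q = 2 * q" by (auto elim!: evenE)
  have "c * (r * r + 3 * (t * t)) - 2 * (p * p + 3 * (q * q)) = 2 * (- u)"
    using u'' unfolding pq by (simp add: algebra_simps)
  then have "even (c * (r * r + 3 * (t * t)))" by (rule gen')
  then have "even (r - t)" using c(2) by auto
  moreover have "2 * x = quad (sqrt 3) (sqrt s) (2 * of_int p) (2 * of_int q) (of_int r) (of_int t)"
    using eq unfolding rt pq by (simp add: quad_def algebra_simps)
  ultimately show ?thesis using that by blast
qed

text \<open>\<open>\<omega>\<close> is a root of X^2 - n X - \<nu>, hence integral. The class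
  condition makes \<open>n\<close> congruent to 1 or to sqrt 3 modulo 2; both are units there, which
  yields \<open>par\<close>.\<close>

lemma quadratic_order_odd:
  assumes \<nu>: "4 * \<nu> = of_nat s - n * n"
    and cls: "s mod 4 = 1 \<and> odd (rpart n) \<and> even (spart n) \<or> s mod 4 = 3 \<and> even (rpart n) \<and> odd (spart n)"
  shows "quadratic_order (carrier (ring_of_integers K)) ((emb n + sqrt s) / 2) n \<nu>"
proof -
  define \<omega> where "\<omega> = (emb n + sqrt s) / 2"
  have "4 * emb \<nu> = real s - emb n * emb n"
    using arg_cong[OF \<nu>, of emb] by simp
  then have emb_\<nu>: "emb \<nu> = (real s - emb n * emb n) / 4" by simp
  have sq: "\<omega> * \<omega> = emb n * \<omega> + emb \<nu>"
    by (simp add: \<omega>_def emb_\<nu> field_simps)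
  have odd: "odd s" using cls by presburger
  have mem: "lin_comb \<omega> d b \<in> carrier (ring_of_integers K)" for d b
    unfolding mem_ring_of_integers
    using algebraic_int_lin_comb[OF sq] by (auto simp: lin_comb_def \<omega>_def intro!: K_closed emb_mem_K)
  have rep: "\<exists>d b. x = lin_comb \<omega> d b" if x: "x \<in> carrier (ring_of_integers K)" for x
  proof -
    obtain P Q r t u v :: int where
      eq: "2 * x = quad (sqrt 3) (sqrt s) (of_int P) (of_int Q) (of_int r) (of_int t)"
      and u: "P * P + 3 * (Q * Q) - int s * (r * r + 3 * (t * t)) = 4 * u"
      and v: "P * Q - int s * (r * t) = 2 * v"
      using integral_coefficients_odd[OF x odd] by metis
    obtain P' Q' r' t' where sqs: "P * P = 4 * P' + P mod 2" "Q * Q = 4 * Q' + Q mod 2"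
      "r * r = 4 * r' + r mod 2" "t * t = 4 * t' + t mod 2"
      using square_mod_4[of P] square_mod_4[of Q] square_mod_4[of r] square_mod_4[of t] by blast
    define w where "w = r * r + 3 * (t * t)"
    have w: "w = 4 * r' + r mod 2 + 3 * (4 * t' + t mod 2)" unfolding w_def sqs ..
    have "P * P + 3 * (Q * Q) - int s * w = 4 * u"
      using u unfolding w_def .
    then have u: "4 * P' + P mod 2 + 3 * (4 * Q' + Q mod 2) - int s * w = 4 * u"
      unfolding sqs(1,2) .
    have v: "even P \<or> even Q \<longleftrightarrow> even r \<or> even t"
    proof -
      have "even (P * Q - int s * (r * t))" unfolding v by simp
      then show ?thesis using odd by auto
    qed
    \<comment> \<open>Together: P + Q sqrt 3 is congruent to (r + t sqrt 3) n modulo 2. This is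
      exactly what makes the \<int>[sqrt 3]-coordinates of \<open>x\<close> integral.\<close>
    have par: "even (P - (rpart n * r + 3 * (spart n * t)))" "even (Q - (rpart n * t + spart n * r))"
    proof -
      consider "s mod 4 = 1" "odd (rpart n)" "even (spart n)" | "s mod 4 = 3" "even (rpart n)" "odd (spart n)"
        using cls by blast
      then have "even (P - (rpart n * r + 3 * (spart n * t))) \<and> even (Q - (rpart n * t + spart n * r))"
      proof cases
        case 1
        define k where "k = int (s div 4)"
        have "int s = 4 * k + 1" using 1(1) unfolding k_def by presburger
        then have "4 * P' + P mod 2 + 3 * (4 * Q' + Q mod 2) - (4 * (k * w) + w) = 4 * u"
          using u by (simp add: algebra_simps)
        then have "even (P - r) \<and> even (Q - t)" using v w by presburger
        then show ?thesis using 1(2,3) by auto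
      next
        case 2
        define k where "k = int (s div 4)"
        have "int s = 4 * k + 3" using 2(1) unfolding k_def by presburger
        then have "4 * P' + P mod 2 + 3 * (4 * Q' + Q mod 2) - (4 * (k * w) + 3 * w) = 4 * u"
          using u by (simp add: algebra_simps)
        then have "even (P - t) \<and> even (Q - r)" using v w by presburger
        then show ?thesis using 2(2,3) by auto
      qed
      then show "even (P - (rpart n * r + 3 * (spart n * t)))" "even (Q - (rpart n * t + spart n * r))" by blast+
    qed
    then obtain y z where yz: "P - (rpart n * r + 3 * (spart n * t)) = 2 * y" "Q - (rpart n * t + spart n * r) = 2 * z"
      by (elim evenE)
    have "Z3 P Q = 2 * Z3 y z + Z3 r t * n"
      using yz by (simp add: zsqrt3_eq_iff algebra_simps)
    then have "emb (Z3 P Q) = 2 * emb (Z3 y z) + emb (Z3 r t) * emb n" by simp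
    moreover have "2 * x = emb (Z3 P Q) + emb (Z3 r t) * sqrt s"
      unfolding eq by (simp add: quad_def emb_def algebra_simps)
    ultimately have "x = lin_comb \<omega> (Z3 y z) (Z3 r t)"
      by (simp add: lin_comb_def \<omega>_def field_simps)
    then show ?thesis by blast
  qed
  show ?thesis
    unfolding \<omega>_def[symmetric]
  proof
    show "carrier (ring_of_integers K) = {lin_comb \<omega> d b |d b. True}"
      using mem rep by blast
    show "d = d' \<and> b = b'" if "lin_comb \<omega> d b = lin_comb \<omega> d' b'" for d b d' b'
    proof -
      have "emb (2 * (d - d') + (b - b') * n) + emb (b - b') * sqrt s = 0"
        using that by (simp add: lin_comb_def \<omega>_def field_simps)
      then have "2 * (d - d') + (b - b') * n = 0" "b - b' = 0" using emb_sqrt_indep by blast+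
      then show ?thesis by (simp add: zsqrt3_eq_iff)
    qed
    show "\<omega> * \<omega> = emb n * \<omega> + emb \<nu>" by (rule sq)
    show "\<exists>z. t = 2 * z" if "2 * u = n * t" for u t
    proof -
      have "even (rpart n * rpart t + 3 * (spart n * spart t))" "even (rpart n * spart t + spart n * rpart t)"
        using arg_cong[OF that, of rpart] arg_cong[OF that, of spart] by (metis zsqrt3_parts(11,12) zsqrt3_numeral dvd_triv_left mult_zero_left mult_zero_right add_0_right)+
      then have "even (rpart t) \<and> even (spart t)" using cls by auto
      then obtain a b where "rpart t = 2 * a" "spart t = 2 * b" by (auto elim!: evenE)
      then have "t = 2 * Z3 a b" by (simp add: zsqrt3_eq_iff)
      then show ?thesis by blast
    qed
  qed
qed

end

section \<open>Rigidity of the Gram matrix\<close>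

text \<open>After multiplication by \<open>s\<close>, completing the squares shows that (x, y) lies
  in an ellipse centred at (k/s, l/s). The hypotheses say that the lines |x| = M + 1 and |y| = N + 1
  are outside it.\<close>

lemma box_bound:
  fixes s \<Delta> k l x y M N :: int
  assumes U: "0 \<le> \<Delta> + 2 * (k * x + 3 * (l * y)) - s * (x * x + 3 * (y * y))" and s: "0 < s"
    and M: "\<bar>k\<bar> \<le> s * (M + 1)" "s * \<Delta> + k * k + 3 * (l * l) < (s * (M + 1) - \<bar>k\<bar>)\<^sup>2"
    and N: "\<bar>l\<bar> \<le> s * (N + 1)" "s * \<Delta> + k * k + 3 * (l * l) < 3 * (s * (N + 1) - \<bar>l\<bar>)\<^sup>2"
  shows "\<bar>x\<bar> \<le> M \<and> \<bar>y\<bar> \<le> N"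
proof -
  have "0 \<le> s * (\<Delta> + 2 * (k * x + 3 * (l * y)) - s * (x * x + 3 * (y * y)))"
    using U s by simp
  also have "\<dots> = s * \<Delta> + k * k + 3 * (l * l) - ((s * x - k)\<^sup>2 + 3 * (s * y - l)\<^sup>2)"
    by (simp add: power2_eq_square algebra_simps)
  finally have le: "(s * x - k)\<^sup>2 + 3 * (s * y - l)\<^sup>2 \<le> s * \<Delta> + k * k + 3 * (l * l)" by simp
  have far: "(s * (Z + 1) - \<bar>c\<bar>)\<^sup>2 \<le> (s * z - c)\<^sup>2" if "\<not> \<bar>z\<bar> \<le> Z" "\<bar>c\<bar> \<le> s * (Z + 1)" for z c Z
  proof -
    have "s * (Z + 1) \<le> s * \<bar>z\<bar>" using that(1) s by (intro mult_left_mono) simp_all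
    also have "\<dots> = \<bar>s * z\<bar>" using s by (simp add: abs_mult)
    finally have "\<bar>s * (Z + 1) - \<bar>c\<bar>\<bar> \<le> \<bar>s * z - c\<bar>" using that(2) by arith
    then show ?thesis by (rule abs_le_square_iff[THEN iffD1])
  qed
  show ?thesis
  proof (rule ccontr)
    assume "\<not> (\<bar>x\<bar> \<le> M \<and> \<bar>y\<bar> \<le> N)"
    then consider "\<not> \<bar>x\<bar> \<le> M" | "\<not> \<bar>y\<bar> \<le> N" by blast
    then show False
    proof cases
      case 1
      have "0 \<le> 3 * (s * y - l)\<^sup>2" by simp
      then show False using far[OF 1 M(1)] M(2) le by linarith
    next
      case 2
      have "0 \<le> (s * x - k)\<^sup>2" by simp
      then show False using far[OF 2 N(1)] N(2) le by linarith
    qed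
  qed
qed

lemma sqrt_bracket: "\<exists>r::nat. r * r \<le> s \<and> s < (r + 1) * (r + 1)"
proof (induction s)
  case (Suc s)
  then obtain r where r: "r * r \<le> s" "s < (r + 1) * (r + 1)" by blast
  show ?case
  proof (cases "Suc s < (r + 1) * (r + 1)")
    case True
    then show ?thesis using r(1) by (intro exI[of _ r]) simp
  next
    case False
    then show ?thesis using r(2) by (intro exI[of _ "r + 1"]) simp
  qed
qed simp

context biquadratic
begin

text \<open>Since (1 + sqrt 3)^2 = 2 (2 + sqrt 3), the number \<omega> - n is a square root of c (2
  + sqrt 3) and thus integral, whatever \<open>n\<close> is.\<close>

lemma quadratic_order_even:
  assumes s: "int s = 2 * c" "odd c"
  shows "quadratic_order (carrier (ring_of_integers K)) (emb n + (1 + sqrt 3) / 2 * sqrt s)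
    (2 * n) (of_int c * Z3 2 1 - n * n)"
proof -
  define \<nu> where "\<nu> = of_int c * Z3 2 1 - n * n"
  define \<omega> where "\<omega> = emb n + (1 + sqrt 3) / 2 * sqrt s"
  have s4: "s mod 4 = 2" using s by presburger
  have real_s: "real s = 2 * of_int c"
    using arg_cong[OF s(1), of real_of_int] by simp
  have square: "(a / 2 * b) * (a / 2 * b) = (a * a) * (b * b) / 4" for a b :: real
    by simp
  have scale: "(4 + 2 * x) * (2 * y) / 4 = y * (2 + x)" for x y :: real
    by (simp add: algebra_simps)
  have "\<omega> - emb n = (1 + sqrt 3) / 2 * sqrt s" by (simp add: \<omega>_def)
  then have "(\<omega> - emb n) * (\<omega> - emb n) = ((1 + sqrt 3) * (1 + sqrt 3)) * (sqrt s * sqrt s) / 4"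
    by (simp only: square)
  also have "(1 + sqrt 3) * (1 + sqrt 3) = 4 + 2 * sqrt 3" by (simp add: algebra_simps)
  also have "sqrt s * sqrt s = 2 * of_int c" unfolding sqrts(2) by (rule real_s)
  also have "(4 + 2 * sqrt 3) * (2 * of_int c) / 4 = of_int c * emb (Z3 2 1)"
    unfolding scale by (simp add: emb_def)
  finally have sq': "(\<omega> - emb n) * (\<omega> - emb n) = of_int c * emb (Z3 2 1)" .
  have emb_c: "emb (of_int c) = of_int c" by (simp add: emb_def)
  have sq: "\<omega> * \<omega> = emb (2 * n) * \<omega> + emb \<nu>"
    using sq' by (simp add: \<nu>_def emb_c algebra_simps)
  have two_\<omega>: "2 * \<omega> = 2 * emb n + emb (Z3 1 1) * sqrt s"
    by (simp add: \<omega>_def emb_def algebra_simps)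
  have one: "1 \<in> K" using K_closed(6)[of 1] by simp
  have "\<omega> = emb n + (1 + sqrt 3) * sqrt s / 2" by (simp add: \<omega>_def)
  then have "\<omega> \<in> K" by (simp only:) (intro K_closed emb_mem_K one)
  then have mem: "lin_comb \<omega> d b \<in> carrier (ring_of_integers K)" for d b
    unfolding mem_ring_of_integers
    using algebraic_int_lin_comb[OF sq] by (auto simp: lin_comb_def intro!: K_closed emb_mem_K)
  have rep: "\<exists>d b. x = lin_comb \<omega> d b" if x: "x \<in> carrier (ring_of_integers K)" for x
  proof -
    obtain P Q r t :: int where
      eq: "2 * x = quad (sqrt 3) (sqrt s) (2 * of_int P) (2 * of_int Q) (of_int r) (of_int t)"
      and "even (r - t)"
      using integral_coefficients_even[OF x s4] by metis
    then obtain y where y: "r - t = 2 * y" by (elim evenE)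
    \<comment> \<open>For r and t of equal parity r + t sqrt 3 is divisible by 1 + sqrt 3;
      \<open>b\<close> is the quotient.\<close>
    define b where "b = Z3 (t - y) y"
    define d where "d = Z3 P Q - b * n"
    have "Z3 r t = b * Z3 1 1" using y by (simp add: b_def zsqrt3_eq_iff)
    moreover have "2 * x = 2 * emb (Z3 P Q) + emb (Z3 r t) * sqrt s"
      unfolding eq by (simp add: quad_def emb_def algebra_simps)
    ultimately have "2 * x = 2 * (emb d + emb b * emb n) + emb b * (2 * \<omega> - 2 * emb n)"
      by (simp add: two_\<omega> d_def)
    then have "x = lin_comb \<omega> d b" by (simp add: lin_comb_def algebra_simps)
    then show ?thesis by blast
  qed
  show ?thesis
    unfolding \<omega>_def[symmetric] \<nu>_def[symmetric]
  proof
    show "carrier (ring_of_integers K) = {lin_comb \<omega> d b |d b. True}"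
      using mem rep by blast
    show "d = d' \<and> b = b'" if "lin_comb \<omega> d b = lin_comb \<omega> d' b'" for d b d' b'
    proof -
      have "emb (2 * (d - d') + 2 * ((b - b') * n)) + emb ((b - b') * Z3 1 1) * sqrt s
          = 2 * (emb d - emb d') + (emb b - emb b') * (2 * \<omega>)"
        unfolding two_\<omega> by (simp add: algebra_simps)
      also have "\<dots> = 0"
        using that by (simp add: lin_comb_def algebra_simps)
      finally have "2 * (d - d') + 2 * ((b - b') * n) = 0" "(b - b') * Z3 1 1 = 0"
        using emb_sqrt_indep by blast+
      moreover from this(2) have "b = b'" by (simp add: zsqrt3_eq_iff)
      ultimately show ?thesis by (simp add: zsqrt3_eq_iff)
    qed
    show "\<omega> * \<omega> = emb (2 * n) * \<omega> + emb \<nu>" by (rule sq)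
    show "\<exists>z. t = 2 * z" if ev: "even (spart t)" "even (spart (\<nu> * t))" for t
    proof -
      \<comment> \<open>The trace \<open>2 * n\<close> says nothing about \<open>t\<close> modulo 2.
        Given that \<open>spart t\<close> is even, the oddness of \<open>spart \<nu>\<close> carries
        the parity of \<open>rpart t\<close> into \<open>spart (\<nu> * t)\<close>.\<close>
      have "odd (spart \<nu>)" using s(2) by (simp add: \<nu>_def)
      then have "even (rpart t)" using ev by auto
      then obtain a b where "rpart t = 2 * a" "spart t = 2 * b" using ev(1) by (auto elim!: evenE)
      then have "t = 2 * Z3 a b" by (simp add: zsqrt3_eq_iff)
      then show ?thesis by blast
    qed
  qed
qed

text \<open>Here \<nu> = k - w sqrt 3, and \<open>\<kappa>r\<close>, \<open>\<kappa>s\<close> are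
  the coordinates of (7 + 2 sqrt 3)(1 - \<nu>) + (2 + sqrt 3) n. The discriminant is s. The premises
  of \<open>rigid\<close> are the trace and norm conditions on 54 + 24 sqrt 3 + 2 \<kappa> z - s z^2
  for z = x + y sqrt 3.\<close>

lemma six_le_odd:
  assumes k: "int s = nr * nr + 3 * (ns * ns) + 4 * k" and w: "nr * ns = 2 * w"
    and cls: "s mod 4 = 1 \<and> odd nr \<or> s mod 4 = 3 \<and> even nr"
    and \<kappa>: "\<kappa>r = 7 * (1 - k) + 6 * w + 2 * nr + 3 * ns" "\<kappa>s = 2 * (1 - k) + 7 * w + 2 * ns + nr"
    and rigid: "\<And>x y. 0 \<le> 54 + 2 * (\<kappa>r * x + 3 * (\<kappa>s * y)) - int s * (x * x + 3 * (y * y)) \<Longrightarrow>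
      3 * (24 + 2 * (\<kappa>r * y + \<kappa>s * x) - 2 * (int s * (x * y)))\<^sup>2 \<le>
        (54 + 2 * (\<kappa>r * x + 3 * (\<kappa>s * y)) - int s * (x * x + 3 * (y * y)))\<^sup>2 \<Longrightarrow> x = 0 \<and> y = 0"
  shows "6 \<le> pythagoras_number (ring_of_integers K)"
proof -
  define n where "n = Z3 nr ns"
  define \<nu> where "\<nu> = Z3 k (- w)"
  have "spart (of_nat s) = 0" "rpart (of_nat s) = int s" by simp_all
  then have \<nu>: "4 * \<nu> = of_nat s - n * n"
    using k w by (simp add: n_def \<nu>_def zsqrt3_eq_iff mult.commute)
  have par: "even (nr * ns)" unfolding w by simp
  have "int s mod 4 = (nr * nr + 3 * (ns * ns)) mod 4" unfolding k by simp
  then have "odd (int s) \<longleftrightarrow> odd (nr * nr + 3 * (ns * ns))" unfolding k by simp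
  moreover have "odd s" using cls by presburger
  ultimately have "odd nr \<longleftrightarrow> even ns" by simp
  then have cls': "s mod 4 = 1 \<and> odd (rpart n) \<and> even (spart n) \<or> s mod 4 = 3 \<and> even (rpart n) \<and> odd (spart n)"
    using cls by (auto simp: n_def)
  interpret quadratic_order "carrier (ring_of_integers K)" "(emb n + sqrt s) / 2" n \<nu>
    by (rule quadratic_order_odd[OF \<nu> cls'])
  show ?thesis
  proof (rule six_le_pythagoras_number[OF refl needs_six_squares_7_2, of 1 1 1 0 0])
    fix z
    have \<sigma>: "4 * \<nu> + n * n = of_nat s" using \<nu> by simp
    assume "totally_nonneg (form_bilin (Z3 7 2) (Z3 2 1) (Z3 7 2) 1 0 1 0 * form_bilin (Z3 7 2) (Z3 2 1) (Z3 7 2) 0 1 0 1 -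
      form_bilin (Z3 7 2) (Z3 2 1) (Z3 7 2) 1 0 0 1 * form_bilin (Z3 7 2) (Z3 2 1) (Z3 7 2) 1 0 0 1 +
      2 * (form_bilin (Z3 7 2) (Z3 2 1) (Z3 7 2) 0 1 0 1 - \<nu> * form_bilin (Z3 7 2) (Z3 2 1) (Z3 7 2) 1 0 1 0 +
        form_bilin (Z3 7 2) (Z3 2 1) (Z3 7 2) 1 0 0 1 * n) * z - (4 * \<nu> + n * n) * (z * z))"
    then have nonneg: "totally_nonneg (Z3 7 2 * Z3 7 2 - Z3 2 1 * Z3 2 1 + 2 * (Z3 7 2 - \<nu> * Z3 7 2 + Z3 2 1 * n) * z
        - of_nat s * (z * z))"
      unfolding \<sigma> by (simp only: form_bilin_def mult_1_left mult_1_right mult_zero_left mult_zero_right add_0_left add_0_right)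
    have parts: "rpart (Z3 7 2 * Z3 7 2 - Z3 2 1 * Z3 2 1 + 2 * (Z3 7 2 - \<nu> * Z3 7 2 + Z3 2 1 * n) * z - of_nat s * (z * z)) =
        54 + 2 * (\<kappa>r * rpart z + 3 * (\<kappa>s * spart z)) - int s * (rpart z * rpart z + 3 * (spart z * spart z))"
      "spart (Z3 7 2 * Z3 7 2 - Z3 2 1 * Z3 2 1 + 2 * (Z3 7 2 - \<nu> * Z3 7 2 + Z3 2 1 * n) * z - of_nat s * (z * z)) =
        24 + 2 * (\<kappa>r * spart z + \<kappa>s * rpart z) - 2 * (int s * (rpart z * spart z))"
      unfolding \<kappa> by (simp_all add: n_def \<nu>_def algebra_simps)
    have "rpart z = 0 \<and> spart z = 0"
      using totally_nonnegD[OF nonneg] unfolding parts by (rule rigid)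
    then show "z = 0" by (simp add: zsqrt3_eq_iff)
  qed simp
qed

text \<open>The trace condition alone separates into an x-part and three times a y-part; this is why
  the thresholds are 54 and 18 = 54/3.\<close>

lemma six_le_odd_of_bounds:
  assumes k: "int s = nr * nr + 3 * (ns * ns) + 4 * k" and w: "nr * ns = 2 * w"
    and cls: "s mod 4 = 1 \<and> odd nr \<or> s mod 4 = 3 \<and> even nr"
    and \<kappa>: "\<kappa>r = 7 * (1 - k) + 6 * w + 2 * nr + 3 * ns" "\<kappa>s = 2 * (1 - k) + 7 * w + 2 * ns + nr"
    and bounds: "2 * \<kappa>r + 54 < int s" "54 - 2 * \<kappa>r < int s" "2 * \<kappa>s + 18 < int s" "18 - 2 * \<kappa>s < int s"
  shows "6 \<le> pythagoras_number (ring_of_integers K)"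
proof (rule six_le_odd[OF k w cls \<kappa>])
  fix x y :: int
  assume U: "0 \<le> 54 + 2 * (\<kappa>r * x + 3 * (\<kappa>s * y)) - int s * (x * x + 3 * (y * y))"
  have b: "2 * \<bar>\<kappa>r\<bar> + 54 < int s" "2 * \<bar>\<kappa>s\<bar> + 18 < int s" using bounds by arith+
  have U': "(int s * (x * x) - 2 * (\<kappa>r * x)) + 3 * (int s * (y * y) - 2 * (\<kappa>s * y)) \<le> 54"
    using U by (simp add: algebra_simps)
  show "x = 0 \<and> y = 0"
    using quadratic_form_gt[OF b(1), of x] quadratic_form_gt[OF b(2), of y] U' by fastforce
qed

end

context biquadratic
begin

text \<open>The version for small s, with a free choice of form and basis. The trace confines (x, y)
  to |x| <= 2 and |y| <= 1 (the factors 3 and 2 of \<open>s\<close> in \<open>box\<close> are these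
  bounds plus one), and the fifteen points are tested against trace and norm.\<close>

lemma six_le_odd_of_box:
  assumes \<nu>: "4 * \<nu> = of_nat s - n * n"
    and cls: "s mod 4 = 1 \<and> odd (rpart n) \<and> even (spart n) \<or> s mod 4 = 3 \<and> even (rpart n) \<and> odd (spart n)"
    and form: "needs_six_squares A B C"
    and unit: "e * (p * t - q * r) = 1"
    and \<Delta>: "form_bilin A B C p q p q * form_bilin A B C r t r t - form_bilin A B C p q r t * form_bilin A B C p q r t
      = Z3 \<Delta>r \<Delta>s"
    and \<kappa>: "form_bilin A B C r t r t - \<nu> * form_bilin A B C p q p q + form_bilin A B C p q r t * n = Z3 \<kappa>r \<kappa>s"
    and box: "\<bar>\<kappa>r\<bar> \<le> 3 * int s" "int s * \<Delta>r + \<kappa>r * \<kappa>r + 3 * (\<kappa>s * \<kappa>s) < (3 * int s - \<bar>\<kappa>r\<bar>)\<^sup>2"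
      "\<bar>\<kappa>s\<bar> \<le> 2 * int s" "int s * \<Delta>r + \<kappa>r * \<kappa>r + 3 * (\<kappa>s * \<kappa>s) < 3 * (2 * int s - \<bar>\<kappa>s\<bar>)\<^sup>2"
    and check: "\<forall>x\<in>{- 2, - 1, 0, 1, 2}. \<forall>y\<in>{- 1, 0, 1}.
      0 \<le> \<Delta>r + 2 * (\<kappa>r * x + 3 * (\<kappa>s * y)) - int s * (x * x + 3 * (y * y)) \<longrightarrow>
      3 * (\<Delta>s + 2 * (\<kappa>r * y + \<kappa>s * x) - 2 * (int s * (x * y)))\<^sup>2 \<le>
        (\<Delta>r + 2 * (\<kappa>r * x + 3 * (\<kappa>s * y)) - int s * (x * x + 3 * (y * y)))\<^sup>2 \<longrightarrow> x = 0 \<and> y = 0"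
  shows "6 \<le> pythagoras_number (ring_of_integers K)"
proof -
  interpret quadratic_order "carrier (ring_of_integers K)" "(emb n + sqrt s) / 2" n \<nu>
    by (rule quadratic_order_odd[OF \<nu> cls])
  show ?thesis
  proof (rule six_le_pythagoras_number[OF refl form unit])
    fix z
    have \<sigma>: "4 * \<nu> + n * n = of_nat s" using \<nu> by simp
    assume "totally_nonneg (form_bilin A B C p q p q * form_bilin A B C r t r t -
      form_bilin A B C p q r t * form_bilin A B C p q r t +
      2 * (form_bilin A B C r t r t - \<nu> * form_bilin A B C p q p q + form_bilin A B C p q r t * n) * z -
      (4 * \<nu> + n * n) * (z * z))"
    then have nonneg: "totally_nonneg (Z3 \<Delta>r \<Delta>s + 2 * Z3 \<kappa>r \<kappa>s * z - of_nat s * (z * z))"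
      unfolding \<Delta> \<kappa> \<sigma> .
    define x where "x = rpart z"
    define y where "y = spart z"
    have parts: "rpart (Z3 \<Delta>r \<Delta>s + 2 * Z3 \<kappa>r \<kappa>s * z - of_nat s * (z * z)) =
        \<Delta>r + 2 * (\<kappa>r * x + 3 * (\<kappa>s * y)) - int s * (x * x + 3 * (y * y))"
      "spart (Z3 \<Delta>r \<Delta>s + 2 * Z3 \<kappa>r \<kappa>s * z - of_nat s * (z * z)) =
        \<Delta>s + 2 * (\<kappa>r * y + \<kappa>s * x) - 2 * (int s * (x * y))"
      by (simp_all add: x_def y_def algebra_simps)
    note U = totally_nonnegD[OF nonneg, unfolded parts]
    have "\<bar>x\<bar> \<le> 2 \<and> \<bar>y\<bar> \<le> 1"
      using box s_gt_1 by (intro box_bound[OF U(1)]) (simp_all add: mult.commute)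
    then have "x \<in> {- 2, - 1, 0, 1, 2}" "y \<in> {- 1, 0, 1}" by auto
    then have "x = 0 \<and> y = 0" using check U by blast
    then show "z = 0" by (simp add: x_def y_def zsqrt3_eq_iff)
  qed
qed

text \<open>The discriminant is now 4c (2 + sqrt 3). Its product with z^2 has the coordinates 8c
  (x^2 + 3xy + 3y^2) and 4c (x^2 + 4xy + 3y^2).\<close>

lemma six_le_even:
  assumes s: "int s = 2 * c" "odd c"
    and \<kappa>: "\<kappa>r = 7 * (1 - (2 * c - nr * nr - 3 * (ns * ns))) - 6 * (c - 2 * (nr * ns)) + 2 * (2 * nr + 3 * ns)"
      "\<kappa>s = 2 * (1 - (2 * c - nr * nr - 3 * (ns * ns))) - 7 * (c - 2 * (nr * ns)) + 2 * (2 * ns + nr)"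
    and rigid: "\<And>x y. 0 \<le> 54 + 2 * (\<kappa>r * x + 3 * (\<kappa>s * y)) - 8 * c * (x * x + 3 * (x * y) + 3 * (y * y)) \<Longrightarrow>
      3 * (24 + 2 * (\<kappa>r * y + \<kappa>s * x) - 4 * c * (x * x + 4 * (x * y) + 3 * (y * y)))\<^sup>2 \<le>
        (54 + 2 * (\<kappa>r * x + 3 * (\<kappa>s * y)) - 8 * c * (x * x + 3 * (x * y) + 3 * (y * y)))\<^sup>2 \<Longrightarrow> x = 0 \<and> y = 0"
  shows "6 \<le> pythagoras_number (ring_of_integers K)"
proof -
  define n where "n = Z3 nr ns"
  define \<nu> where "\<nu> = of_int c * Z3 2 1 - n * n"
  interpret quadratic_order "carrier (ring_of_integers K)" "emb n + (1 + sqrt 3) / 2 * sqrt s" "2 * n" \<nu>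
    unfolding \<nu>_def by (rule quadratic_order_even[OF s])
  show ?thesis
  proof (rule six_le_pythagoras_number[OF refl needs_six_squares_7_2, of 1 1 1 0 0])
    fix z
    have \<sigma>: "4 * \<nu> + 2 * n * (2 * n) = of_int (4 * c) * Z3 2 1"
      by (simp add: \<nu>_def zsqrt3_eq_iff algebra_simps)
    assume "totally_nonneg (form_bilin (Z3 7 2) (Z3 2 1) (Z3 7 2) 1 0 1 0 * form_bilin (Z3 7 2) (Z3 2 1) (Z3 7 2) 0 1 0 1 -
      form_bilin (Z3 7 2) (Z3 2 1) (Z3 7 2) 1 0 0 1 * form_bilin (Z3 7 2) (Z3 2 1) (Z3 7 2) 1 0 0 1 +
      2 * (form_bilin (Z3 7 2) (Z3 2 1) (Z3 7 2) 0 1 0 1 - \<nu> * form_bilin (Z3 7 2) (Z3 2 1) (Z3 7 2) 1 0 1 0 +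
        form_bilin (Z3 7 2) (Z3 2 1) (Z3 7 2) 1 0 0 1 * (2 * n)) * z - (4 * \<nu> + 2 * n * (2 * n)) * (z * z))"
    then have nonneg: "totally_nonneg (Z3 7 2 * Z3 7 2 - Z3 2 1 * Z3 2 1
        + 2 * (Z3 7 2 - \<nu> * Z3 7 2 + Z3 2 1 * (2 * n)) * z - of_int (4 * c) * Z3 2 1 * (z * z))"
      unfolding \<sigma> by (simp only: form_bilin_def mult_1_left mult_1_right mult_zero_left mult_zero_right add_0_left add_0_right)
    have parts: "rpart (Z3 7 2 * Z3 7 2 - Z3 2 1 * Z3 2 1
        + 2 * (Z3 7 2 - \<nu> * Z3 7 2 + Z3 2 1 * (2 * n)) * z - of_int (4 * c) * Z3 2 1 * (z * z)) =
        54 + 2 * (\<kappa>r * rpart z + 3 * (\<kappa>s * spart z))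
          - 8 * c * (rpart z * rpart z + 3 * (rpart z * spart z) + 3 * (spart z * spart z))"
      "spart (Z3 7 2 * Z3 7 2 - Z3 2 1 * Z3 2 1
        + 2 * (Z3 7 2 - \<nu> * Z3 7 2 + Z3 2 1 * (2 * n)) * z - of_int (4 * c) * Z3 2 1 * (z * z)) =
        24 + 2 * (\<kappa>r * spart z + \<kappa>s * rpart z)
          - 4 * c * (rpart z * rpart z + 4 * (rpart z * spart z) + 3 * (spart z * spart z))"
      unfolding \<kappa> by (simp_all add: n_def \<nu>_def algebra_simps)
    have "rpart z = 0 \<and> spart z = 0"
      using totally_nonnegD[OF nonneg] unfolding parts by (rule rigid)
    then show "z = 0" by (simp add: zsqrt3_eq_iff)
  qed simp
qed

text \<open>x^2 + 3xy + 3y^2 is the hexagonal form u^2 + uy + y^2 with u = x + y. The six bounds say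
  that the trace condition fails at its six minimal vectors, and this already excludes every nonzero
  point.\<close>

lemma six_le_even_of_bounds:
  assumes s: "int s = 2 * c" "odd c"
    and \<kappa>: "\<kappa>r = 7 * (1 - (2 * c - nr * nr - 3 * (ns * ns))) - 6 * (c - 2 * (nr * ns)) + 2 * (2 * nr + 3 * ns)"
      "\<kappa>s = 2 * (1 - (2 * c - nr * nr - 3 * (ns * ns))) - 7 * (c - 2 * (nr * ns)) + 2 * (2 * ns + nr)"
    and bounds: "2 * \<kappa>r + 54 < 8 * c" "54 - 2 * \<kappa>r < 8 * c"
      "2 * (3 * \<kappa>s - \<kappa>r) + 54 < 8 * c" "54 - 2 * (3 * \<kappa>s - \<kappa>r) < 8 * c"
      "2 * (2 * \<kappa>r - 3 * \<kappa>s) + 54 < 8 * c" "54 - 2 * (2 * \<kappa>r - 3 * \<kappa>s) < 8 * c"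
  shows "6 \<le> pythagoras_number (ring_of_integers K)"
proof (rule six_le_even[OF s \<kappa>])
  fix x y :: int
  assume U: "0 \<le> 54 + 2 * (\<kappa>r * x + 3 * (\<kappa>s * y)) - 8 * c * (x * x + 3 * (x * y) + 3 * (y * y))"
  define l where "l = 3 * \<kappa>s - \<kappa>r"
  have b: "2 * \<bar>\<kappa>r\<bar> + 54 < 8 * c" "2 * \<bar>l\<bar> + 54 < 8 * c" "2 * \<bar>\<kappa>r - l\<bar> + 54 < 8 * c" "2 * \<bar>l - \<kappa>r\<bar> + 54 < 8 * c"
    using bounds unfolding l_def by arith+
  define u where "u = x + y"
  define v where "v = x + 2 * y"
  have form: "8 * c * (x * x + 3 * (x * y) + 3 * (y * y)) - 2 * (\<kappa>r * x + 3 * (\<kappa>s * y)) =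
      8 * c * (u * u + u * y + y * y) - 2 * (\<kappa>r * u + l * y)"
    "8 * c * (x * x + 3 * (x * y) + 3 * (y * y)) - 2 * (\<kappa>r * x + 3 * (\<kappa>s * y)) =
      8 * c * (v * v + v * (- y) + (- y) * (- y)) - 2 * (\<kappa>r * v + (\<kappa>r - l) * (- y))"
    "8 * c * (x * x + 3 * (x * y) + 3 * (y * y)) - 2 * (\<kappa>r * x + 3 * (\<kappa>s * y)) =
      8 * c * (v * v + v * (- u) + (- u) * (- u)) - 2 * (l * v + (l - \<kappa>r) * (- u))"
    by (simp_all add: u_def v_def l_def algebra_simps)
  show "x = 0 \<and> y = 0"
  proof (rule ccontr)
    assume "\<not> (x = 0 \<and> y = 0)"
    then have nz: "u \<noteq> 0 \<or> y \<noteq> 0" "v \<noteq> 0 \<or> - y \<noteq> 0" "v \<noteq> 0 \<or> - u \<noteq> 0"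
      unfolding u_def v_def by auto
    \<comment> \<open>The three coordinate systems in \<open>form\<close> cut the plane into six
      sectors. Each point has coordinates of equal sign in one of the systems, and there
      \<open>hexagonal_form_gt\<close> applies.\<close>
    have "0 \<le> u \<and> 0 \<le> y \<or> u \<le> 0 \<and> y \<le> 0 \<or> 0 \<le> v \<and> y \<le> 0 \<or> v \<le> 0 \<and> 0 \<le> y \<or> 0 \<le> v \<and> u \<le> 0 \<or> v \<le> 0 \<and> 0 \<le> u"
      unfolding u_def v_def by arith
    then have "0 \<le> u * y \<or> 0 \<le> v * (- y) \<or> 0 \<le> v * (- u)"
      by (auto simp: zero_le_mult_iff mult_le_0_iff)
    then have "54 < 8 * c * (x * x + 3 * (x * y) + 3 * (y * y)) - 2 * (\<kappa>r * x + 3 * (\<kappa>s * y))"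
    proof (elim disjE)
      assume "0 \<le> u * y"
      then show ?thesis unfolding form(1) by (intro hexagonal_form_gt b nz) simp_all
    next
      assume "0 \<le> v * (- y)"
      then show ?thesis unfolding form(2) by (intro hexagonal_form_gt b nz) simp_all
    next
      assume "0 \<le> v * (- u)"
      then show ?thesis unfolding form(3) by (intro hexagonal_form_gt b nz) simp_all
    qed
    then show False using U by linarith
  qed
qed

section \<open>Individual small values of s\<close>

lemma six_le_17: "s = 17 \<Longrightarrow> 6 \<le> pythagoras_number (ring_of_integers K)"
  \<comment> \<open>The form is evaluated at (- \<omega> - 1, \<omega>).\<close>
  by (rule six_le_odd_of_box[where n = "Z3 3 0" and \<nu> = "Z3 2 0"
        and p = "Z3 (- 1) 0" and q = "Z3 1 0" and r = "Z3 (- 1) 0" and t = "Z3 0 0" and e = "Z3 1 0"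
        and \<kappa>r = "2" and \<kappa>s = "1" and \<Delta>r = "54" and \<Delta>s = "24", OF _ _ needs_six_squares_7_2])
    (simp_all add: form_bilin_def zsqrt3_eq_iff)

lemma six_le_19: "s = 19 \<Longrightarrow> 6 \<le> pythagoras_number (ring_of_integers K)"
  \<comment> \<open>The form is evaluated at (\<omega>, 1 - sqrt 3 \<omega>).\<close>
  by (rule six_le_odd_of_box[where n = "Z3 0 3" and \<nu> = "Z3 (- 2) 0"
        and p = "Z3 1 0" and q = "Z3 0 (- 1)" and r = "Z3 0 0" and t = "Z3 1 0" and e = "Z3 1 0"
        and \<kappa>r = "- 3" and \<kappa>s = "- 2" and \<Delta>r = "54" and \<Delta>s = "24", OF _ _ needs_six_squares_7_2])
    (simp_all add: form_bilin_def zsqrt3_eq_iff)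

lemma six_le_23: "s = 23 \<Longrightarrow> 6 \<le> pythagoras_number (ring_of_integers K)"
  \<comment> \<open>The second form is evaluated at (\<omega>, 2 - sqrt 3). The unit 2 - sqrt 3 has
    inverse \<open>e\<close>, and scaling by it turns the determinant 108 + 54 sqrt 3 into 108 - 54
    sqrt 3.\<close>
  by (rule six_le_odd_of_box[where n = "Z3 0 (- 3)" and \<nu> = "Z3 (- 1) 0"
        and p = "Z3 1 0" and q = "Z3 0 0" and r = "Z3 0 0" and t = "Z3 2 (- 1)" and e = "Z3 2 1"
        and \<kappa>r = "- 9" and \<kappa>s = "3" and \<Delta>r = "108" and \<Delta>s = "- 54", OF _ _ needs_six_squares_18_6])
    (simp_all add: form_bilin_def zsqrt3_eq_iff)

text \<open>From here to \<open>six_le_59\<close> the pair is (\<omega>, 1) and only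
  \<open>n\<close> varies. Up to 54 the bounds of \<open>six_le_odd_of_bounds\<close> cannot hold;
  at 55 and 59 they fail for the listed \<open>n\<close>.\<close>

lemma six_le_29: "s = 29 \<Longrightarrow> 6 \<le> pythagoras_number (ring_of_integers K)"
  by (rule six_le_odd_of_box[where n = "Z3 (- 5) 0" and \<nu> = "Z3 1 0"
        and p = "Z3 1 0" and q = "Z3 0 0" and r = "Z3 0 0" and t = "Z3 1 0" and e = "Z3 1 0"
        and \<kappa>r = "- 10" and \<kappa>s = "- 5" and \<Delta>r = "54" and \<Delta>s = "24", OF _ _ needs_six_squares_7_2])
    (simp_all add: form_bilin_def zsqrt3_eq_iff)

lemma six_le_31: "s = 31 \<Longrightarrow> 6 \<le> pythagoras_number (ring_of_integers K)"
  by (rule six_le_odd_of_box[where n = "Z3 0 (- 3)" and \<nu> = "Z3 1 0"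
        and p = "Z3 1 0" and q = "Z3 0 0" and r = "Z3 0 0" and t = "Z3 1 0" and e = "Z3 1 0"
        and \<kappa>r = "- 9" and \<kappa>s = "- 6" and \<Delta>r = "54" and \<Delta>s = "24", OF _ _ needs_six_squares_7_2])
    (simp_all add: form_bilin_def zsqrt3_eq_iff)

lemma six_le_35: "s = 35 \<Longrightarrow> 6 \<le> pythagoras_number (ring_of_integers K)"
  by (rule six_le_odd_of_box[where n = "Z3 0 (- 3)" and \<nu> = "Z3 2 0"
        and p = "Z3 1 0" and q = "Z3 0 0" and r = "Z3 0 0" and t = "Z3 1 0" and e = "Z3 1 0"
        and \<kappa>r = "- 16" and \<kappa>s = "- 8" and \<Delta>r = "54" and \<Delta>s = "24", OF _ _ needs_six_squares_7_2])
    (simp_all add: form_bilin_def zsqrt3_eq_iff)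

lemma six_le_37: "s = 37 \<Longrightarrow> 6 \<le> pythagoras_number (ring_of_integers K)"
  by (rule six_le_odd_of_box[where n = "Z3 (- 7) 0" and \<nu> = "Z3 (- 3) 0"
        and p = "Z3 1 0" and q = "Z3 0 0" and r = "Z3 0 0" and t = "Z3 1 0" and e = "Z3 1 0"
        and \<kappa>r = "14" and \<kappa>s = "1" and \<Delta>r = "54" and \<Delta>s = "24", OF _ _ needs_six_squares_7_2])
    (simp_all add: form_bilin_def zsqrt3_eq_iff)

lemma six_le_41: "s = 41 \<Longrightarrow> 6 \<le> pythagoras_number (ring_of_integers K)"
  by (rule six_le_odd_of_box[where n = "Z3 (- 7) 0" and \<nu> = "Z3 (- 2) 0"
        and p = "Z3 1 0" and q = "Z3 0 0" and r = "Z3 0 0" and t = "Z3 1 0" and e = "Z3 1 0"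
        and \<kappa>r = "7" and \<kappa>s = "- 1" and \<Delta>r = "54" and \<Delta>s = "24", OF _ _ needs_six_squares_7_2])
    (simp_all add: form_bilin_def zsqrt3_eq_iff)

lemma six_le_43: "s = 43 \<Longrightarrow> 6 \<le> pythagoras_number (ring_of_integers K)"
  by (rule six_le_odd_of_box[where n = "Z3 0 3" and \<nu> = "Z3 4 0"
        and p = "Z3 1 0" and q = "Z3 0 0" and r = "Z3 0 0" and t = "Z3 1 0" and e = "Z3 1 0"
        and \<kappa>r = "- 12" and \<kappa>s = "0" and \<Delta>r = "54" and \<Delta>s = "24", OF _ _ needs_six_squares_7_2])
    (simp_all add: form_bilin_def zsqrt3_eq_iff)

lemma six_le_47: "s = 47 \<Longrightarrow> 6 \<le> pythagoras_number (ring_of_integers K)"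
  by (rule six_le_odd_of_box[where n = "Z3 0 3" and \<nu> = "Z3 5 0"
        and p = "Z3 1 0" and q = "Z3 0 0" and r = "Z3 0 0" and t = "Z3 1 0" and e = "Z3 1 0"
        and \<kappa>r = "- 19" and \<kappa>s = "- 2" and \<Delta>r = "54" and \<Delta>s = "24", OF _ _ needs_six_squares_7_2])
    (simp_all add: form_bilin_def zsqrt3_eq_iff)

lemma six_le_53: "s = 53 \<Longrightarrow> 6 \<le> pythagoras_number (ring_of_integers K)"
  by (rule six_le_odd_of_box[where n = "Z3 (- 7) 0" and \<nu> = "Z3 1 0"
        and p = "Z3 1 0" and q = "Z3 0 0" and r = "Z3 0 0" and t = "Z3 1 0" and e = "Z3 1 0"
        and \<kappa>r = "- 14" and \<kappa>s = "- 7" and \<Delta>r = "54" and \<Delta>s = "24", OF _ _ needs_six_squares_7_2])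
    (simp_all add: form_bilin_def zsqrt3_eq_iff)

lemma six_le_55: "s = 55 \<Longrightarrow> 6 \<le> pythagoras_number (ring_of_integers K)"
  by (rule six_le_odd_of_box[where n = "Z3 2 3" and \<nu> = "Z3 6 (- 3)"
        and p = "Z3 1 0" and q = "Z3 0 0" and r = "Z3 0 0" and t = "Z3 1 0" and e = "Z3 1 0"
        and \<kappa>r = "- 4" and \<kappa>s = "19" and \<Delta>r = "54" and \<Delta>s = "24", OF _ _ needs_six_squares_7_2])
    (simp_all add: form_bilin_def zsqrt3_eq_iff)

lemma six_le_59: "s = 59 \<Longrightarrow> 6 \<le> pythagoras_number (ring_of_integers K)"
  by (rule six_le_odd_of_box[where n = "Z3 (- 4) (- 3)" and \<nu> = "Z3 4 (- 6)"
        and p = "Z3 1 0" and q = "Z3 0 0" and r = "Z3 0 0" and t = "Z3 1 0" and e = "Z3 1 0"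
        and \<kappa>r = "- 2" and \<kappa>s = "26" and \<Delta>r = "54" and \<Delta>s = "24", OF _ _ needs_six_squares_7_2])
    (simp_all add: form_bilin_def zsqrt3_eq_iff)

text \<open>The hexagonal bounds narrowly fail for this \<open>n\<close>: \<kappa>r = -18 gives 2 *
  18 + 54 = 90 against 8c = 88. The norm condition closes the gap.\<close>

lemma six_le_22: "s = 22 \<Longrightarrow> 6 \<le> pythagoras_number (ring_of_integers K)"
proof (rule six_le_even[where nr = "- 3" and ns = "- 2" and c = 11, OF _ _ refl refl])
  fix x y :: int
  let ?U = "54 + 2 * ((7 * (1 - (2 * 11 - - 3 * - 3 - 3 * (- 2 * - 2))) - 6 * (11 - 2 * (- 3 * - 2)) + 2 * (2 * - 3 + 3 * - 2)) * x +
    3 * ((2 * (1 - (2 * 11 - - 3 * - 3 - 3 * (- 2 * - 2))) - 7 * (11 - 2 * (- 3 * - 2)) + 2 * (2 * - 2 + - 3)) * y)) -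
    8 * 11 * (x * x + 3 * (x * y) + 3 * (y * y))"
  let ?V = "24 + 2 * ((7 * (1 - (2 * 11 - - 3 * - 3 - 3 * (- 2 * - 2))) - 6 * (11 - 2 * (- 3 * - 2)) + 2 * (2 * - 3 + 3 * - 2)) * y +
    (2 * (1 - (2 * 11 - - 3 * - 3 - 3 * (- 2 * - 2))) - 7 * (11 - 2 * (- 3 * - 2)) + 2 * (2 * - 2 + - 3)) * x) -
    4 * 11 * (x * x + 4 * (x * y) + 3 * (y * y))"
  assume U: "0 \<le> ?U" and V: "3 * ?V\<^sup>2 \<le> ?U\<^sup>2"
  \<comment> \<open>This diagonalises the form, 4 (x^2 + 3xy + 3y^2) = v^2 + 3y^2, so that
    \<open>box_bound\<close> applies to four times the trace condition.\<close>
  define v where "v = 2 * x + 3 * y"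
  have "0 \<le> 216 + 2 * (- 36 * v + 3 * (8 * y)) - 88 * (v * v + 3 * (y * y))"
    using U by (simp add: v_def algebra_simps)
  then have "\<bar>v\<bar> \<le> 2 \<and> \<bar>y\<bar> \<le> 1" by (rule box_bound) simp_all
  then have "v \<in> {- 2, - 1, 0, 1, 2}" "y = - 1 \<or> y = 0 \<or> y = 1" by auto
  then have "x = - 2 \<or> x = - 1 \<or> x = 0 \<or> x = 1 \<or> x = 2" "y = - 1 \<or> y = 0 \<or> y = 1" unfolding v_def by auto
  then show "x = 0 \<and> y = 0" using U V by (elim disjE) simp_all
qed simp_all

text \<open>With \<open>n\<close> a rational odd integer within 1 of sqrt s up to sign, \<nu> = k
  and \<kappa> grow only linearly in sqrt s, while the bounds allow growth proportional to
  s.\<close>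

lemma six_le_of_ge_144:
  assumes cls: "s mod 4 = 1" and ge: "144 \<le> s"
  shows "6 \<le> pythagoras_number (ring_of_integers K)"
proof -
  obtain r where r: "r * r \<le> s" "s < (r + 1) * (r + 1)" using sqrt_bracket by blast
  \<comment> \<open>Of the two integers around sqrt s, \<open>m\<close> is the odd one.\<close>
  define m :: int where "m = (if odd r then int r else int r + 1)"
  have "int (r * r) \<le> int s" "int s < int ((r + 1) * (r + 1))" using r by (simp_all only: of_nat_le_iff of_nat_less_iff)
  then have r': "int r * int r \<le> int s" "int s < (int r + 1) * (int r + 1)" by (simp_all add: algebra_simps)
  have r0: "12 \<le> int r"
  proof (rule ccontr)
    assume "\<not> 12 \<le> int r"
    then have "(int r + 1) * (int r + 1) \<le> 12 * 12" by (intro mult_mono) simp_all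
    then show False using r'(2) ge by simp
  qed
  have m: "odd m" "12 < m" using r0 by (auto simp: m_def intro: le_neq_trans)
  have lo: "m * m - 2 * m + 1 \<le> int s" and hi: "int s < m * m + 2 * m + 1"
    using r' r0 by (auto simp: m_def algebra_simps)
  define m' where "m' = m div 2"
  have m': "m = 2 * m' + 1" using m(1) unfolding m'_def by presburger
  define j where "j = int (s div 4)"
  have j: "int s = 4 * j + 1" using cls unfolding j_def by presburger
  define k where "k = j - m' * m' - m'"
  have k: "int s = m * m + 4 * k" unfolding k_def j m' by (simp add: algebra_simps)
  \<comment> \<open>This trades s >= (m - 1)^2 for a bound linear in \<open>m\<close>, so that
    linear arithmetic can finish.\<close>
  have "0 \<le> (m - 13) * (m - 1)" using m by simp
  then have big: "12 * m - 12 \<le> int s" using lo by (simp add: algebra_simps)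
  have kb: "1 - 2 * m \<le> 4 * k" "4 * k \<le> 2 * m" using lo hi unfolding k by linarith+
  show ?thesis
  \<comment> \<open>The sign of n is chosen so that 2n opposes 7 (1 - k) in \<kappa>r.\<close>
  proof (cases "0 < k")
    case True
    show ?thesis
    proof (rule six_le_odd_of_bounds[where nr = "m" and ns = 0 and k = k and w = 0, OF _ _ _ refl refl])
      show "int s = m * m + 3 * (0 * 0) + 4 * k" using k by simp
      show "s mod 4 = 1 \<and> odd (m) \<or> s mod 4 = 3 \<and> even (m)" using cls m(1) by simp
      show "2 * (7 * (1 - k) + 6 * 0 + 2 * m + 3 * 0) + 54 < int s" using True kb big m(2) by simp
      show "54 - 2 * (7 * (1 - k) + 6 * 0 + 2 * m + 3 * 0) < int s" using True kb big m(2) by simp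
      show "2 * (2 * (1 - k) + 7 * 0 + 2 * 0 + m) + 18 < int s" using True kb big m(2) by simp
      show "18 - 2 * (2 * (1 - k) + 7 * 0 + 2 * 0 + m) < int s" using True kb big m(2) by simp
    qed simp
  next
    case False
    show ?thesis
    proof (rule six_le_odd_of_bounds[where nr = "- m" and ns = 0 and k = k and w = 0, OF _ _ _ refl refl])
      show "int s = - m * - m + 3 * (0 * 0) + 4 * k" using k by simp
      show "s mod 4 = 1 \<and> odd (- m) \<or> s mod 4 = 3 \<and> even (- m)" using cls m(1) by simp
      show "2 * (7 * (1 - k) + 6 * 0 + 2 * - m + 3 * 0) + 54 < int s" using False kb big m(2) by simp
      show "54 - 2 * (7 * (1 - k) + 6 * 0 + 2 * - m + 3 * 0) < int s" using False kb big m(2) by simp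
      show "2 * (2 * (1 - k) + 7 * 0 + 2 * 0 + - m) + 18 < int s" using False kb big m(2) by simp
      show "18 - 2 * (2 * (1 - k) + 7 * 0 + 2 * 0 + - m) < int s" using False kb big m(2) by simp
    qed simp
  qed
qed

section \<open>Covering the residue classes modulo 4\<close>

lemma not_square_dvd: "1 < a \<Longrightarrow> \<not> a\<^sup>2 dvd s"
  using squarefreeD[OF squarefree, of a] by auto

text \<open>For fixed \<open>n\<close> the coordinates of \<kappa> are affine in \<open>j\<close>,
  so one \<open>n\<close> serves a whole interval of s. The intervals bridge the gap between the
  individual values and the uniform range from 144 on.\<close>

lemma six_le_class_1:
  assumes cls: "s mod 4 = 1" and ge: "17 \<le> s"
  shows "6 \<le> pythagoras_number (ring_of_integers K)"
proof -
  define j where "j = int (s div 4)"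
  have j: "int s = 4 * j + 1" using cls unfolding j_def by presburger
  note covered = six_le_17 six_le_29 six_le_37 six_le_41 six_le_53 six_le_of_ge_144[OF cls]
  have "6 \<le> pythagoras_number (ring_of_integers K)" if "61 \<le> s" "s \<le> 61"
    by (rule six_le_odd_of_bounds[where nr = "7" and ns = "0" and k = "j - 12" and w = "0", OF _ _ _ refl refl])
      (use j cls that in simp_all)
  note covered = covered this
  have "6 \<le> pythagoras_number (ring_of_integers K)" if "65 \<le> s" "s \<le> 73"
    by (rule six_le_odd_of_bounds[where nr = "1" and ns = "4" and k = "j - 12" and w = "2", OF _ _ _ refl refl])
      (use j cls that in simp_all)
  note covered = covered this
  have "6 \<le> pythagoras_number (ring_of_integers K)" if "77 \<le> s" "s \<le> 77"
    by (rule six_le_odd_of_bounds[where nr = "- 9" and ns = "0" and k = "j - 20" and w = "0", OF _ _ _ refl refl])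
      (use j cls that in simp_all)
  note covered = covered this
  have "6 \<le> pythagoras_number (ring_of_integers K)" if "85 \<le> s" "s \<le> 109"
    by (rule six_le_odd_of_bounds[where nr = "1" and ns = "- 6" and k = "j - 27" and w = "- 3", OF _ _ _ refl refl])
      (use j cls that in simp_all)
  note covered = covered this
  have "6 \<le> pythagoras_number (ring_of_integers K)" if "109 \<le> s" "s \<le> 137"
    by (rule six_le_odd_of_bounds[where nr = "- 9" and ns = "- 2" and k = "j - 23" and w = "9", OF _ _ _ refl refl])
      (use j cls that in simp_all)
  note covered = covered this
  have excluded: "s \<noteq> 25" "s \<noteq> 49" using not_square_dvd[of 5] not_square_dvd[of 7] by auto
  have excluded': "s \<noteq> 21" "s \<noteq> 33" "s \<noteq> 45" "s \<noteq> 57" "s \<noteq> 69" "s \<noteq> 81" "s \<noteq> 141" using not_3_dvd by auto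
  show ?thesis
  proof (rule ccontr)
    assume neg: "\<not> ?thesis"
    have not_covered: "s \<noteq> 17" "s \<noteq> 29" "s \<noteq> 37" "s \<noteq> 41" "s \<noteq> 53"
      "\<not> (61 \<le> s \<and> s \<le> 61)" "\<not> (65 \<le> s \<and> s \<le> 73)" "\<not> (77 \<le> s \<and> s \<le> 77)" "\<not> (85 \<le> s \<and> s \<le> 109)" "\<not> (109 \<le> s \<and> s \<le> 137)" "\<not> 144 \<le> s"
      using covered neg by blast+
    \<comment> \<open>The covering is checked in stages, each raising the least value of s still
      possible.\<close>
    have "33 \<le> s"
      using cls ge \<open>s \<noteq> 17\<close> \<open>s \<noteq> 21\<close> \<open>s \<noteq> 25\<close> \<open>s \<noteq> 29\<close> by presburger
    then have "49 \<le> s"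
      using cls \<open>s \<noteq> 33\<close> \<open>s \<noteq> 37\<close> \<open>s \<noteq> 41\<close> \<open>s \<noteq> 45\<close> by presburger
    then have "65 \<le> s"
      using cls \<open>s \<noteq> 49\<close> \<open>s \<noteq> 53\<close> \<open>s \<noteq> 57\<close> \<open>\<not> (61 \<le> s \<and> s \<le> 61)\<close> by presburger
    then have "113 \<le> s"
      using cls \<open>\<not> (65 \<le> s \<and> s \<le> 73)\<close> \<open>\<not> (77 \<le> s \<and> s \<le> 77)\<close> \<open>s \<noteq> 81\<close> \<open>\<not> (85 \<le> s \<and> s \<le> 109)\<close> by presburger
    then have "145 \<le> s"
      using cls \<open>\<not> (109 \<le> s \<and> s \<le> 137)\<close> \<open>s \<noteq> 141\<close> by presburger
    then show False using \<open>\<not> 144 \<le> s\<close> by simp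
  qed
qed

lemma six_le_class_3:
  assumes cls: "s mod 4 = 3" and ge: "17 \<le> s" "s \<le> 511"
  shows "6 \<le> pythagoras_number (ring_of_integers K)"
proof -
  define j where "j = int (s div 4)"
  have j: "int s = 4 * j + 3" using cls unfolding j_def by presburger
  note covered = six_le_19 six_le_23 six_le_31 six_le_35 six_le_43 six_le_47 six_le_55 six_le_59
  have "6 \<le> pythagoras_number (ring_of_integers K)" if "67 \<le> s" "s \<le> 71"
    by (rule six_le_odd_of_bounds[where nr = "0" and ns = "- 5" and k = "j - 18" and w = "0", OF _ _ _ refl refl])
      (use j cls that in simp_all)
  note covered = covered this
  have "6 \<le> pythagoras_number (ring_of_integers K)" if "71 \<le> s" "s \<le> 79"
    by (rule six_le_odd_of_bounds[where nr = "- 8" and ns = "- 1" and k = "j - 16" and w = "4", OF _ _ _ refl refl])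
      (use j cls that in simp_all)
  note covered = covered this
  have "6 \<le> pythagoras_number (ring_of_integers K)" if "83 \<le> s" "s \<le> 103"
    by (rule six_le_odd_of_bounds[where nr = "- 2" and ns = "- 5" and k = "j - 19" and w = "5", OF _ _ _ refl refl])
      (use j cls that in simp_all)
  note covered = covered this
  have "6 \<le> pythagoras_number (ring_of_integers K)" if "103 \<le> s" "s \<le> 131"
    by (rule six_le_odd_of_bounds[where nr = "- 10" and ns = "- 1" and k = "j - 25" and w = "5", OF _ _ _ refl refl])
      (use j cls that in simp_all)
  note covered = covered this
  have "6 \<le> pythagoras_number (ring_of_integers K)" if "139 \<le> s" "s \<le> 191"
    by (rule six_le_odd_of_bounds[where nr = "- 12" and ns = "- 1" and k = "j - 36" and w = "6", OF _ _ _ refl refl])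
      (use j cls that in simp_all)
  note covered = covered this
  have "6 \<le> pythagoras_number (ring_of_integers K)" if "199 \<le> s" "s \<le> 299"
    by (rule six_le_odd_of_bounds[where nr = "- 2" and ns = "9" and k = "j - 61" and w = "- 9", OF _ _ _ refl refl])
      (use j cls that in simp_all)
  note covered = covered this
  have "6 \<le> pythagoras_number (ring_of_integers K)" if "299 \<le> s" "s \<le> 467"
    by (rule six_le_odd_of_bounds[where nr = "- 20" and ns = "1" and k = "j - 100" and w = "- 10", OF _ _ _ refl refl])
      (use j cls that in simp_all)
  note covered = covered this
  have "6 \<le> pythagoras_number (ring_of_integers K)" if "467 \<le> s" "s \<le> 511"
    by (rule six_le_odd_of_bounds[where nr = "- 22" and ns = "3" and k = "j - 127" and w = "- 33", OF _ _ _ refl refl])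
      (use j cls that in simp_all)
  note covered = covered this
  have excluded: "s \<noteq> 27" "s \<noteq> 39" "s \<noteq> 51" "s \<noteq> 63" "s \<noteq> 135" "s \<noteq> 195" using not_3_dvd by auto
  show ?thesis
  proof (rule ccontr)
    assume neg: "\<not> ?thesis"
    have not_covered: "s \<noteq> 19" "s \<noteq> 23" "s \<noteq> 31" "s \<noteq> 35" "s \<noteq> 43" "s \<noteq> 47" "s \<noteq> 55" "s \<noteq> 59"
      "\<not> (67 \<le> s \<and> s \<le> 71)" "\<not> (71 \<le> s \<and> s \<le> 79)" "\<not> (83 \<le> s \<and> s \<le> 103)" "\<not> (103 \<le> s \<and> s \<le> 131)" "\<not> (139 \<le> s \<and> s \<le> 191)" "\<not> (199 \<le> s \<and> s \<le> 299)" "\<not> (299 \<le> s \<and> s \<le> 467)" "\<not> (467 \<le> s \<and> s \<le> 511)"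
      using covered neg by blast+
    have "35 \<le> s"
      using cls ge(1) \<open>s \<noteq> 19\<close> \<open>s \<noteq> 23\<close> \<open>s \<noteq> 27\<close> \<open>s \<noteq> 31\<close> by presburger
    then have "51 \<le> s"
      using cls \<open>s \<noteq> 35\<close> \<open>s \<noteq> 39\<close> \<open>s \<noteq> 43\<close> \<open>s \<noteq> 47\<close> by presburger
    then have "67 \<le> s"
      using cls \<open>s \<noteq> 51\<close> \<open>s \<noteq> 55\<close> \<open>s \<noteq> 59\<close> \<open>s \<noteq> 63\<close> by presburger
    then have "135 \<le> s"
      using cls \<open>\<not> (67 \<le> s \<and> s \<le> 71)\<close> \<open>\<not> (71 \<le> s \<and> s \<le> 79)\<close> \<open>\<not> (83 \<le> s \<and> s \<le> 103)\<close> \<open>\<not> (103 \<le> s \<and> s \<le> 131)\<close> by presburger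
    then have "303 \<le> s"
      using cls \<open>s \<noteq> 135\<close> \<open>\<not> (139 \<le> s \<and> s \<le> 191)\<close> \<open>s \<noteq> 195\<close> \<open>\<not> (199 \<le> s \<and> s \<le> 299)\<close> by presburger
    then have "515 \<le> s"
      using cls \<open>\<not> (299 \<le> s \<and> s \<le> 467)\<close> \<open>\<not> (467 \<le> s \<and> s \<le> 511)\<close> by presburger
    then show False using ge(2) by simp
  qed
qed

text \<open>The target for the square of \<open>n\<close> is now c (2 + sqrt 3), whose two
  conjugates differ by a factor of about 14; each \<open>n\<close> of the table approximates it
  roughly in both embeddings.\<close>

lemma six_le_class_2:
  assumes cls: "s mod 4 = 2" and ge: "17 \<le> s" "s \<le> 511"
  shows "6 \<le> pythagoras_number (ring_of_integers K)"
proof -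
  define c where "c = int (s div 2)"
  have c: "int s = 2 * c" "odd c" using cls unfolding c_def by presburger+
  note covered = six_le_22
  have "6 \<le> pythagoras_number (ring_of_integers K)" if "26 \<le> s" "s \<le> 26"
    by (rule six_le_even_of_bounds[where nr = "- 4" and ns = "- 2" and c = c, OF _ _ refl refl])
      (use c that in simp_all)
  note covered = covered this
  have "6 \<le> pythagoras_number (ring_of_integers K)" if "34 \<le> s" "s \<le> 38"
    by (rule six_le_even_of_bounds[where nr = "- 5" and ns = "- 2" and c = c, OF _ _ refl refl])
      (use c that in simp_all)
  note covered = covered this
  have "6 \<le> pythagoras_number (ring_of_integers K)" if "46 \<le> s" "s \<le> 46"
    by (rule six_le_even_of_bounds[where nr = "- 6" and ns = "- 2" and c = c, OF _ _ refl refl])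
      (use c that in simp_all)
  note covered = covered this
  have "6 \<le> pythagoras_number (ring_of_integers K)" if "58 \<le> s" "s \<le> 62"
    by (rule six_le_even_of_bounds[where nr = "- 7" and ns = "- 2" and c = c, OF _ _ refl refl])
      (use c that in simp_all)
  note covered = covered this
  have "6 \<le> pythagoras_number (ring_of_integers K)" if "70 \<le> s" "s \<le> 94"
    by (rule six_le_even_of_bounds[where nr = "5" and ns = "4" and c = c, OF _ _ refl refl])
      (use c that in simp_all)
  note covered = covered this
  have "6 \<le> pythagoras_number (ring_of_integers K)" if "106 \<le> s" "s \<le> 146"
    by (rule six_le_even_of_bounds[where nr = "- 10" and ns = "- 3" and c = c, OF _ _ refl refl])
      (use c that in simp_all)
  note covered = covered this
  have "6 \<le> pythagoras_number (ring_of_integers K)" if "154 \<le> s" "s \<le> 218"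
    by (rule six_le_even_of_bounds[where nr = "11" and ns = "4" and c = c, OF _ _ refl refl])
      (use c that in simp_all)
  note covered = covered this
  have "6 \<le> pythagoras_number (ring_of_integers K)" if "226 \<le> s" "s \<le> 326"
    by (rule six_le_even_of_bounds[where nr = "- 14" and ns = "- 5" and c = c, OF _ _ refl refl])
      (use c that in simp_all)
  note covered = covered this
  have "6 \<le> pythagoras_number (ring_of_integers K)" if "326 \<le> s" "s \<le> 466"
    by (rule six_le_even_of_bounds[where nr = "- 18" and ns = "- 5" and c = c, OF _ _ refl refl])
      (use c that in simp_all)
  note covered = covered this
  have "6 \<le> pythagoras_number (ring_of_integers K)" if "466 \<le> s" "s \<le> 506"
    by (rule six_le_even_of_bounds[where nr = "- 19" and ns = "- 5" and c = c, OF _ _ refl refl])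
      (use c that in simp_all)
  note covered = covered this
  have excluded: "s \<noteq> 50" "s \<noteq> 98" using not_square_dvd[of 5] not_square_dvd[of 7] by auto
  have excluded': "s \<noteq> 18" "s \<noteq> 30" "s \<noteq> 42" "s \<noteq> 54" "s \<noteq> 66" "s \<noteq> 102" "s \<noteq> 150" "s \<noteq> 222" "s \<noteq> 510"
    using not_3_dvd by auto
  show ?thesis
  proof (rule ccontr)
    assume neg: "\<not> ?thesis"
    have not_covered: "s \<noteq> 22"
      "\<not> (26 \<le> s \<and> s \<le> 26)" "\<not> (34 \<le> s \<and> s \<le> 38)" "\<not> (46 \<le> s \<and> s \<le> 46)" "\<not> (58 \<le> s \<and> s \<le> 62)" "\<not> (70 \<le> s \<and> s \<le> 94)" "\<not> (106 \<le> s \<and> s \<le> 146)" "\<not> (154 \<le> s \<and> s \<le> 218)" "\<not> (226 \<le> s \<and> s \<le> 326)" "\<not> (326 \<le> s \<and> s \<le> 466)" "\<not> (466 \<le> s \<and> s \<le> 506)"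
      using covered neg by blast+
    have "34 \<le> s"
      using cls ge(1) \<open>s \<noteq> 18\<close> \<open>s \<noteq> 22\<close> \<open>\<not> (26 \<le> s \<and> s \<le> 26)\<close> \<open>s \<noteq> 30\<close> by presburger
    then have "54 \<le> s"
      using cls \<open>\<not> (34 \<le> s \<and> s \<le> 38)\<close> \<open>s \<noteq> 42\<close> \<open>\<not> (46 \<le> s \<and> s \<le> 46)\<close> \<open>s \<noteq> 50\<close> by presburger
    then have "98 \<le> s"
      using cls \<open>s \<noteq> 54\<close> \<open>\<not> (58 \<le> s \<and> s \<le> 62)\<close> \<open>s \<noteq> 66\<close> \<open>\<not> (70 \<le> s \<and> s \<le> 94)\<close> by presburger
    then have "154 \<le> s"
      using cls \<open>s \<noteq> 98\<close> \<open>s \<noteq> 102\<close> \<open>\<not> (106 \<le> s \<and> s \<le> 146)\<close> \<open>s \<noteq> 150\<close> by presburger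
    then have "470 \<le> s"
      using cls \<open>\<not> (154 \<le> s \<and> s \<le> 218)\<close> \<open>s \<noteq> 222\<close> \<open>\<not> (226 \<le> s \<and> s \<le> 326)\<close> \<open>\<not> (326 \<le> s \<and> s \<le> 466)\<close> by presburger
    then have "514 \<le> s"
      using cls \<open>\<not> (466 \<le> s \<and> s \<le> 506)\<close> \<open>s \<noteq> 510\<close> by presburger
    then show False using ge(2) by simp
  qed
qed

lemma six_le_of_le_511:
  assumes ge: "17 \<le> s" "s \<le> 511"
  shows "6 \<le> pythagoras_number (ring_of_integers K)"
proof -
  have "\<not> 4 dvd s" using not_square_dvd[of 2] by simp
  then have "s mod 4 = 1 \<or> s mod 4 = 2 \<or> s mod 4 = 3" by presburger
  then show ?thesis using six_le_class_1 six_le_class_2 six_le_class_3 ge by blast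
qed

end

theorem theorem2p2:
  defines "K \<equiv> \<lambda>s::nat. rat_adjoin {sqrt 3, sqrt (real s)}"
  shows
    "(let E = {s::nat. squarefree s \<and> 17 \<le> s \<and> s \<le> 511 \<and> \<not> 3 dvd s
                \<and> \<not> pythagoras_number (ring_of_integers (K s)) \<ge> 6}
      in E \<subseteq> {170, 178, 230, 238, 362, 442, 446, 454} \<and> card E \<le> 8)
     \<and>
     (\<forall>s::nat. squarefree s \<and> \<not> 3 dvd s \<and> s mod 4 = 1
        \<and> (17 \<le> s \<and> s < 15000
           \<or> 315^2 < s \<and> s < 317^2
           \<or> 999^2 < s \<and> s < 1001^2
           \<or> 3161^2 < s \<and> s < 3165^2)
        \<longrightarrow> pythagoras_number (ring_of_integers (K s)) \<ge> 6)"
proof -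
  have small: "6 \<le> pythagoras_number (ring_of_integers (K s))"
    if "squarefree s" "\<not> 3 dvd s" "17 \<le> s" "s \<le> 511" for s
  proof -
    interpret biquadratic s using that by unfold_locales auto
    show ?thesis using six_le_of_le_511 that unfolding assms K_def by blast
  qed
  have class_1: "6 \<le> pythagoras_number (ring_of_integers (K s))"
    if "squarefree s" "\<not> 3 dvd s" "s mod 4 = 1" "17 \<le> s" for s
  proof -
    interpret biquadratic s using that by unfold_locales auto
    show ?thesis using six_le_class_1 that unfolding assms K_def by blast
  qed
  have E: "{s::nat. squarefree s \<and> 17 \<le> s \<and> s \<le> 511 \<and> \<not> 3 dvd s
      \<and> \<not> pythagoras_number (ring_of_integers (K s)) \<ge> 6} = {}"
    using small by blast
  show ?thesis
    \<comment> \<open>All four ranges of the second claim consist of integers s >= 17.\<close>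
    unfolding Let_def E using class_1 by auto
qed

end
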